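(* Let $Z=(Z_1,\dots,Z_n)$ be an $n$-dimensional standard Gaussian vector, let $f:\mathbb{R}^n\to\mathbb{R}$ be a twice differentiable function satisfying $$\lambda_{ik}:=\sup_{x\in\mathbb{R}^n}\left|\frac{\partial^2 f(x)}{\partial x_k\partial x_i}\right|<\infty\quad\text{for all }1\le i\le k\le n,$$ and let $F=f(Z_1,\dots,Z_n)$. Then, for all $x\ge 0$, $$P\left(|F-E[F]|>x\right)\le 4\exp\left(-\frac{2x^2}{\left(\sigma+\sqrt{\sigma^2+4\sqrt{c}\,x}\right)^2}\right),$$ where $\sigma^2=\mathrm{Var}(F)$ and $c=\sum_{k=1}^{n}\sum_{i=1}^{k-1}\lambda_{ik}^2+\frac12\sum_{k=1}^n\lambda_{kk}^2$.
   Context: $\sigma$ denotes the nonnegative square root of $\mathrm{Var}(F)$. *)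

theory Defs
  imports "HOL-Probability.Probability"
begin

text \<open>
  The coordinates of \<open>real ^ 'n\<close> are indexed by a finite linearly ordered type, so
  that \<open>i < k\<close> makes sense for coordinates; the dimension is \<open>CARD('n)\<close>.
\<close>

definition partial_deriv :: "'n::finite \<Rightarrow> (real ^ 'n \<Rightarrow> real) \<Rightarrow> real ^ 'n \<Rightarrow> real" where
  "partial_deriv i f x = deriv (\<lambda>t. f (x + t *\<^sub>R axis i 1)) 0"

text \<open>
  Twice differentiable in the Frechet sense: the derivative, as a map into the normed
  space of bounded linear functionals, is itself differentiable. The second derivative
  need not be continuous.
\<close>

definition twice_differentiable :: "(real ^ 'n::finite \<Rightarrow> real) \<Rightarrow> bool" where
  "twice_differentiable f \<longleftrightarrow>
     (\<exists>f' :: real ^ 'n \<Rightarrow> (real ^ 'n) \<Rightarrow>\<^sub>L real.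
        (\<forall>x. (f has_derivative blinfun_apply (f' x)) (at x)) \<and>
        (\<forall>x. f' differentiable (at x)))"

definition std_gaussian_vector :: "'a measure \<Rightarrow> ('a \<Rightarrow> real ^ 'n::finite) \<Rightarrow> bool" where
  "std_gaussian_vector M Z \<longleftrightarrow>
     prob_space.indep_vars M (\<lambda>_. borel) (\<lambda>i \<omega>. Z \<omega> $ i) UNIV \<and>
     (\<forall>i. distributed M lborel (\<lambda>\<omega>. Z \<omega> $ i) std_normal_density)"

text \<open>
  Convention for the tail bound \<open>4 * exp (- 2 * x\<^sup>2 / d\<^sup>2)\<close> when its denominator
  vanishes (this happens exactly when \<open>F\<close> is degenerate): the exponent is read as minus
  infinity for \<open>x > 0\<close>, so the bound is \<open>0\<close>. As HOL has \<open>t / 0 = 0\<close>, the theorem states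
  this case as a second conjunct. For \<open>x = 0\<close> the quotient \<open>0 / 0\<close> is read as \<open>0\<close>.
\<close>

end

theory Submission imports Defs begin

text \<open>
  Let \<open>f\<close> be centred under the Gaussian measure with gradient \<open>v\<close> and mean gradient \<open>m\<close>, and let \<open>h\<close>
  bound the Hilbert-Schmidt norm of its Hessian, so that \<open>h\<^sup>2 = 2 * c\<close>. For an independent copy \<open>Y\<close> of \<open>X\<close>
  and \<open>X\<^sub>t = cos t * X + sin t * Y\<close>, the derivative of \<open>E[g(X\<^sub>t) G(X)]\<close> is
  \<open>- sin t * E[grad g(X\<^sub>t) \<bullet> grad G(X)]\<close>. Applying this with \<open>w = exp (s * f)\<close> to the pairs \<open>(f, w)\<close>,
  \<open>(v, w * v)\<close> and \<open>(m \<bullet> v, w)\<close> bounds \<open>E[f * w]\<close>, the derivative of the moment generating function,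
  by a multiple of \<open>E[w]\<close>. Integrating in \<open>s\<close> yields the sub-gamma bound
  \<open>E[w] \<le> exp (s\<^sup>2 * (|m|\<^sup>2 + 2/3 * h\<^sup>2) / (2 * (1 - s * h)))\<close> for \<open>s * h < 1\<close>, and Chernoff's method a tail bound
  in terms of \<open>|m|\<close> and \<open>h\<close>. Finally \<open>|m| \<le> \<sigma>\<close>, because \<open>|m|\<^sup>2\<close> is the variance of the projection of
  \<open>f(X)\<close> onto linear functions of \<open>X\<close>.
\<close>

section \<open>The standard Gaussian measure\<close>

text \<open>Put A = E[w], N = E[(m \<bullet> v) w] and Q = E[|v|^2 w]. The covariances of
  \<open>v\<close> with \<open>w * v\<close> and of \<open>m \<bullet> v\<close> with
  \<open>w\<close> bound Q and N by each other and by A. This linear system can be solved for s h <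
  1, and the covariance of \<open>f\<close> with \<open>w\<close> involves nothing beyond N, Q and
  A. The Hilbert-Schmidt norm enters because differentiating \<open>w * v\<close> produces the
  product of two Hessians at different points.

  The variance factor |m|^2 + 2/3 h^2 may exceed \<sigma>^2: for f(x) = (x^2 - 1) / 2 in dimension
  one it is 2/3 against 1/2. The excess is at most 4/3 c and is paid for by the gap between the
  factor 4 of the claim and the factor 2 of a two-sided Chernoff bound.

  Two obstacles shape the analysis. Since \<open>f\<close> may grow quadratically, \<open>w\<close>
  is in general integrable only for limited s, so growth rates exp(a |x|^2) are tracked throughout.
  Since the second derivative may be discontinuous, measurability of the Hessian has to be derived,
  and integration by parts must never fall on it.\<close>

definition gauss :: "'a::euclidean_space measure" where
  "gauss = density lborel (\<lambda>x. ennreal (\<Prod>b\<in>Basis. std_normal_density (x \<bullet> b)))"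

text \<open>Radial form of the product density in \<open>gauss\<close>. The product form suits
  Tonelli and independent coordinates, the radial form suits differentiation along lines and decay
  estimates.\<close>

definition gauss_density :: "'a::euclidean_space \<Rightarrow> real" where
  "gauss_density x = (1 / sqrt (2 * pi)) ^ DIM('a) * exp (- (norm x)\<^sup>2 / 2)"

lemma norm_sq_sum_Basis: "(norm x)\<^sup>2 = (\<Sum>b\<in>Basis. (x \<bullet> b)\<^sup>2)"
  for x :: "'a::euclidean_space"
  using euclidean_inner[of x x] by (simp only: power2_norm_eq_inner flip: power2_eq_square)

lemma gauss_density_prod:
  "(\<Prod>b\<in>Basis. std_normal_density (x \<bullet> b)) = gauss_density (x :: 'a::euclidean_space)"
proof -
  have "(\<Prod>b\<in>Basis. std_normal_density (x \<bullet> b))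
      = (1 / sqrt (2 * pi)) ^ DIM('a) * exp (\<Sum>b\<in>Basis. - (x \<bullet> b)\<^sup>2 / 2)"
    by (simp add: std_normal_density_def prod.distrib exp_sum power_divide prod_dividef)
  also have "(\<Sum>b\<in>Basis. - (x \<bullet> b)\<^sup>2 / 2) = - (\<Sum>b\<in>Basis. (x \<bullet> b)\<^sup>2) / 2"
    by (simp add: sum_negf sum_divide_distrib)
  also have "(\<Sum>b\<in>Basis. (x \<bullet> b)\<^sup>2) = (norm x)\<^sup>2"
    by (rule norm_sq_sum_Basis[symmetric])
  finally show ?thesis by (simp add: gauss_density_def)
qed

lemma gauss_alt: "gauss = density lborel (\<lambda>x. ennreal (gauss_density x))"
  unfolding gauss_def gauss_density_prod ..

lemma gauss_density_pos: "0 < gauss_density x"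
  by (simp add: gauss_density_def)

lemma gauss_density_measurable [measurable]: "gauss_density \<in> borel_measurable borel"
  unfolding gauss_density_def by measurable

lemma space_gauss [simp]: "space gauss = UNIV"
  and sets_gauss [measurable_cong, simp]: "sets gauss = sets borel"
  by (simp_all add: gauss_def)

lemma prob_space_gauss: "prob_space (gauss :: 'a::euclidean_space measure)"
proof
  interpret N: prob_space "density lborel std_normal_density" by (rule prob_space_normal_density) simp
  have "(\<integral>\<^sup>+x. ennreal (\<Prod>b\<in>Basis. std_normal_density (x \<bullet> b)) \<partial>(lborel::'a measure))
      = (\<integral>\<^sup>+x. (\<Prod>b\<in>Basis. ennreal (std_normal_density (x \<bullet> b))) \<partial>(lborel::'a measure))"
    by (simp add: prod_ennreal)
  also have "\<dots> = (\<Prod>b\<in>(Basis::'a set). (\<integral>\<^sup>+x. ennreal (std_normal_density x) \<partial>lborel))"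
    by (rule nn_integral_lborel_prod) auto
  also have "\<dots> = 1"
    using N.emeasure_space_1 by (simp add: emeasure_density)
  finally show "emeasure (gauss :: 'a measure) (space gauss) = 1"
    by (simp add: gauss_def emeasure_density)
qed

interpretation gauss: prob_space "gauss :: 'a::euclidean_space measure"
  by (rule prob_space_gauss)

lemma integrable_lborel_exp_sq:
  assumes "0 < e"
  shows "integrable lborel (\<lambda>x::'a::euclidean_space. exp (- e * (norm x)\<^sup>2))"
proof (rule integrableI_nonneg)
  \<comment> \<open>The standard deviation whose normal density is a multiple of
    \<open>exp (- e * x\<^sup>2)\<close>.\<close>
  define s where "s = sqrt (1 / (2 * e))"
  have s: "s > 0" "s\<^sup>2 = 1 / (2 * e)" using assms by (auto simp: s_def)
  have 1: "integrable lborel (\<lambda>x::real. exp (- e * x\<^sup>2))"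
  proof -
    have "integrable lborel (\<lambda>x. sqrt (2 * pi * s\<^sup>2) * normal_density 0 s x)"
      by (intro integrable_mult_right integrable_normal_density s)
    then show ?thesis
      using s assms by (simp add: normal_density_def field_simps)
  qed
  have eq: "exp (- e * (norm x)\<^sup>2) = (\<Prod>b\<in>Basis. exp (- e * (x \<bullet> b)\<^sup>2))" for x :: 'a
    by (simp add: exp_sum[symmetric] norm_sq_sum_Basis[of x] sum_distrib_left sum_negf)
  have "(\<integral>\<^sup>+x. ennreal (exp (- e * (norm x)\<^sup>2)) \<partial>(lborel::'a measure))
      = (\<integral>\<^sup>+x. (\<Prod>b\<in>Basis. ennreal (exp (- e * (x \<bullet> b)\<^sup>2))) \<partial>(lborel::'a measure))"
    by (simp only: eq) (simp add: prod_ennreal)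
  also have "\<dots> = (\<Prod>b\<in>(Basis::'a set). (\<integral>\<^sup>+x. ennreal (exp (- e * x\<^sup>2)) \<partial>lborel))"
    by (rule nn_integral_lborel_prod) auto
  also have "\<dots> < \<infinity>"
    using 1 by (simp add: integrable_iff_bounded ennreal_prod_eq_top less_top power_less_top_ennreal)
  finally show "(\<integral>\<^sup>+x. ennreal (exp (- e * (norm x)\<^sup>2)) \<partial>(lborel::'a measure)) < \<infinity>" .
qed auto

lemma integrable_gauss_iff:
  "h \<in> borel_measurable borel \<Longrightarrow>
    integrable gauss h \<longleftrightarrow> integrable lborel (\<lambda>x. gauss_density x * h x :: real)"
  unfolding gauss_alt
  by (subst integrable_density) (auto simp: gauss_density_pos less_imp_le)

lemma integral_gauss_eq:
  "h \<in> borel_measurable borel \<Longrightarrow> (\<integral>x. h x \<partial>gauss) = (\<integral>x. gauss_density x * h x \<partial>lborel)"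
  for h :: "'a::euclidean_space \<Rightarrow> real"
  unfolding gauss_alt
  by (subst integral_density) (auto simp: gauss_density_pos less_imp_le)

lemma integrable_gauss_exp_sq:
  assumes "a < 1/2"
  shows "integrable gauss (\<lambda>x::'a::euclidean_space. exp (a * (norm x)\<^sup>2))"
proof -
  have "integrable lborel (\<lambda>x::'a. (1 / sqrt (2 * pi)) ^ DIM('a) * exp (- (1/2 - a) * (norm x)\<^sup>2))"
    using assms by (intro integrable_mult_right integrable_lborel_exp_sq) auto
  also have "(\<lambda>x::'a. (1 / sqrt (2 * pi)) ^ DIM('a) * exp (- (1/2 - a) * (norm x)\<^sup>2))
      = (\<lambda>x. gauss_density x * exp (a * (norm x)\<^sup>2))"
    by (auto simp: gauss_density_def exp_add[symmetric] algebra_simps fun_eq_iff)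
  finally show ?thesis by (subst integrable_gauss_iff) auto
qed

text \<open>Two independent copies become a single Gaussian point of the product space, so that
  growth bounds and integration by parts, proved for every Euclidean space, apply to functions of
  both copies.\<close>

lemma gauss_pair: "(gauss :: ('a::euclidean_space \<times> 'b::euclidean_space) measure) = gauss \<Otimes>\<^sub>M gauss"
proof -
  have g: "gauss_density x * gauss_density y = gauss_density (x, y)" for x :: 'a and y :: 'b
  proof -
    have "exp (- (norm x)\<^sup>2 / 2) * exp (- (norm y)\<^sup>2 / 2) = exp (- (norm (x, y))\<^sup>2 / 2)"
      by (simp add: exp_add[symmetric] norm_Pair field_simps)
    then show ?thesis
      by (simp add: gauss_density_def power_add)
  qed
  have "gauss \<Otimes>\<^sub>M gauss = density (lborel \<Otimes>\<^sub>M lborel)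
      (\<lambda>(x::'a, y::'b). ennreal (gauss_density x) * ennreal (gauss_density y))"
    unfolding gauss_alt
    by (rule pair_measure_density)
       (auto simp: gauss_alt[symmetric] sigma_finite_lborel prob_space_imp_sigma_finite prob_space_gauss)
  also have "\<dots> = density lborel (\<lambda>z::'a \<times> 'b. ennreal (gauss_density z))"
  proof -
    have "(\<lambda>(x::'a, y::'b). ennreal (gauss_density x) * ennreal (gauss_density y))
        = (\<lambda>z. ennreal (gauss_density z))"
      by (auto simp: fun_eq_iff ennreal_mult'[symmetric] gauss_density_pos less_imp_le g)
    then show ?thesis by (simp only: lborel_prod)
  qed
  finally show ?thesis by (simp add: gauss_alt)
qed

text \<open>Boxes form an intersection-stable generator of the Borel sets, and on a box independence
  factorises the probability exactly as Tonelli factorises the Gaussian integral.\<close>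

lemma distr_std_gaussian_vector:
  fixes Z :: "'a \<Rightarrow> real ^ 'n::finite"
  assumes "prob_space M" "std_gaussian_vector M Z"
  shows "Z \<in> borel_measurable M" "distr M borel Z = gauss"
proof -
  interpret prob_space M by fact
  have ind: "indep_vars (\<lambda>_. borel) (\<lambda>i \<omega>. Z \<omega> $ i) UNIV"
    and dist: "\<And>i. distributed M lborel (\<lambda>\<omega>. Z \<omega> $ i) std_normal_density"
    using assms(2) by (auto simp: std_gaussian_vector_def)
  have [measurable]: "(\<lambda>\<omega>. Z \<omega> $ i) \<in> borel_measurable M" for i
    using dist[of i] by (auto simp: distributed_def)
  show Z [measurable]: "Z \<in> borel_measurable M"
    by (subst borel_measurable_euclidean_space)
       (auto simp: Basis_vec_def cart_eq_inner_axis[symmetric])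
  have *: "emeasure (distr M borel Z) (box l u) = emeasure gauss (box l u)" for l u :: "real ^ 'n"
  proof -
    let ?A = "\<lambda>i. {l $ i <..< u $ i}"
    have "Z -` box l u \<inter> space M = (\<Inter>i\<in>UNIV. (\<lambda>\<omega>. Z \<omega> $ i) -` ?A i \<inter> space M)"
      by (auto simp: mem_box_cart)
    then have "emeasure (distr M borel Z) (box l u)
        = ennreal (prob (\<Inter>i\<in>UNIV. (\<lambda>\<omega>. Z \<omega> $ i) -` ?A i \<inter> space M))"
      by (simp add: emeasure_distr emeasure_eq_measure)
    also have "\<dots> = ennreal (\<Prod>i\<in>UNIV. prob ((\<lambda>\<omega>. Z \<omega> $ i) -` ?A i \<inter> space M))"
      by (subst indep_varsD_finite[OF ind]) auto
    also have "\<dots> = (\<Prod>i\<in>UNIV. emeasure (distr M lborel (\<lambda>\<omega>. Z \<omega> $ i)) (?A i))"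
      by (simp add: prod_ennreal[symmetric] emeasure_distr emeasure_eq_measure)
    also have "\<dots> = (\<Prod>i\<in>UNIV. \<integral>\<^sup>+x. ennreal (std_normal_density x) * indicator (?A i) x \<partial>lborel)"
      using dist by (simp add: distributed_def emeasure_density)
    also have "\<dots> = (\<Prod>b\<in>Basis. \<integral>\<^sup>+x. ennreal (std_normal_density x) * indicator {l \<bullet> b <..< u \<bullet> b} x \<partial>lborel)"
    proof -
      have B: "(Basis :: (real^'n) set) = (\<lambda>i. axis i 1) ` UNIV" by (auto simp: Basis_vec_def)
      show ?thesis
        unfolding B by (subst prod.reindex) (auto simp: inj_on_def axis_eq_axis cart_eq_inner_axis[symmetric])
    qed
    also have "\<dots> = (\<integral>\<^sup>+x. (\<Prod>b\<in>Basis. ennreal (std_normal_density (x \<bullet> b)) * indicator {l \<bullet> b <..< u \<bullet> b} (x \<bullet> b)) \<partial>(lborel :: (real^'n) measure))"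
      by (rule nn_integral_lborel_prod[symmetric]) auto
    also have "\<dots> = (\<integral>\<^sup>+x. (\<Prod>b\<in>Basis. ennreal (std_normal_density (x \<bullet> b))) * indicator (box l u) x \<partial>(lborel :: (real^'n) measure))"
    proof (intro nn_integral_cong)
      fix x :: "real^'n"
      have "(\<Prod>b\<in>Basis. indicator {l \<bullet> b <..< u \<bullet> b} (x \<bullet> b)) = (indicator (box l u) x :: ennreal)"
        by (auto simp: indicator_def box_def intro!: prod.neutral prod_zero)
      then show "(\<Prod>b\<in>Basis. ennreal (std_normal_density (x \<bullet> b)) * indicator {l \<bullet> b <..< u \<bullet> b} (x \<bullet> b))
         = (\<Prod>b\<in>Basis. ennreal (std_normal_density (x \<bullet> b))) * indicator (box l u) x"
        by (simp add: prod.distrib)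
    qed
    also have "\<dots> = emeasure gauss (box l u)"
      by (simp add: gauss_def emeasure_density prod_ennreal)
    finally show ?thesis .
  qed
  interpret D: prob_space "distr M borel Z" by (rule prob_space_distr) simp
  show "distr M borel Z = gauss"
  proof (rule measure_eqI_generator_eq)
    let ?E = "range (\<lambda>(a, b). box a b::(real^'n) set)"
    show "Int_stable ?E" by (auto simp: Int_stable_def box_Int_box)
    show "?E \<subseteq> Pow UNIV" "sets (distr M borel Z) = sigma_sets UNIV ?E" "sets gauss = sigma_sets UNIV ?E"
      by (simp_all add: borel_eq_box)
    let ?A = "\<lambda>n::nat. box (- (real n *\<^sub>R One)) (real n *\<^sub>R One) :: (real^'n) set"
    show "range ?A \<subseteq> ?E" "(\<Union>i. ?A i) = UNIV" unfolding UN_box_eq_UNIV by auto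
    show "emeasure (distr M borel Z) (?A i) \<noteq> \<infinity>" for i by (simp add: D.emeasure_eq_measure)
    show "emeasure (distr M borel Z) X = emeasure gauss X" if "X \<in> ?E" for X
      using that * by auto
  qed
qed

section \<open>Gaussian integration by parts\<close>

text \<open>Along any null sequence the difference quotients are dominated by \<open>B\<close>, by
  the mean value inequality, so dominated convergence applies. Measurability of \<open>u' t0\<close>
  is a consequence: it is a pointwise limit of these quotients.\<close>

lemma has_real_derivative_lebesgue_integral:
  fixes u u' :: "real \<Rightarrow> 'a \<Rightarrow> real"
  assumes t0: "t0 \<in> {a<..<b}"
    and der: "\<And>t x. t \<in> {a<..<b} \<Longrightarrow> x \<in> space M \<Longrightarrow> ((\<lambda>t. u t x) has_real_derivative u' t x) (at t)"
    and bnd: "\<And>t x. t \<in> {a<..<b} \<Longrightarrow> x \<in> space M \<Longrightarrow> \<bar>u' t x\<bar> \<le> B x"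
    and B: "integrable M B"
    and u: "\<And>t. t \<in> {a<..<b} \<Longrightarrow> integrable M (u t)"
  shows "((\<lambda>t. \<integral>x. u t x \<partial>M) has_real_derivative (\<integral>x. u' t0 x \<partial>M)) (at t0)"
    and "integrable M (u' t0)"
proof -
  have *: "(\<lambda>n. (\<integral>x. u (t0 + X n) x \<partial>M) / X n - (\<integral>x. u t0 x \<partial>M) / X n) \<longlonglongrightarrow> (\<integral>x. u' t0 x \<partial>M)
      \<and> integrable M (u' t0)"
    if X: "\<And>n. X n \<noteq> 0" "X \<longlonglongrightarrow> 0" for X :: "nat \<Rightarrow> real"
  proof -
    have "(\<lambda>n. t0 + X n) \<longlonglongrightarrow> t0 + 0" by (intro tendsto_intros X)
    then have "eventually (\<lambda>n. t0 + X n \<in> {a<..<b}) sequentially"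
      using t0 by (intro topological_tendstoD) auto
    then obtain N where N: "\<And>n. n \<ge> N \<Longrightarrow> t0 + X n \<in> {a<..<b}"
      by (auto simp: eventually_sequentially)
    \<comment> \<open>Dropping finitely many terms keeps all evaluation points inside the
      interval.\<close>
    define Y where "Y n = X (n + N)" for n
    have Y: "Y n \<noteq> 0" "t0 + Y n \<in> {a<..<b}" for n using X N by (auto simp: Y_def)
    have Y0: "Y \<longlonglongrightarrow> 0" unfolding Y_def using X(2) by (rule LIMSEQ_ignore_initial_segment)
    define s where "s n x = (u (t0 + Y n) x - u t0 x) / Y n" for n x
    have s_int: "integrable M (s n)" for n
      unfolding s_def using Y t0 by (intro integrable_divide Bochner_Integration.integrable_diff u) auto
    have s_lim: "(\<lambda>n. s n x) \<longlonglongrightarrow> u' t0 x" if "x \<in> space M" for x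
    proof -
      have "((\<lambda>h. (u (t0 + h) x - u t0 x) / h) \<longlongrightarrow> u' t0 x) (at 0)"
        using der[OF t0 that] by (simp add: DERIV_def)
      then have "((\<lambda>h. (u (t0 + h) x - u t0 x) / h) \<circ> Y) \<longlonglongrightarrow> u' t0 x"
        using Y0 Y(1) by (subst (asm) tendsto_at_iff_sequentially) auto
      then show ?thesis by (simp add: s_def o_def)
    qed
    have s_bnd: "\<bar>s n x\<bar> \<le> B x" if x: "x \<in> space M" for n x
    proof -
      have "\<bar>u (t0 + Y n) x - u t0 x\<bar> \<le> B x * \<bar>t0 + Y n - t0\<bar>"
      proof -
        have "norm (u (t0 + Y n) x - u t0 x) \<le> B x * norm (t0 + Y n - t0)"
        proof (rule field_differentiable_bound)
          show "convex {a<..<b}" by simp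
          show "((\<lambda>t. u t x) has_real_derivative u' z x) (at z within {a<..<b})" if "z \<in> {a<..<b}" for z
            using der[OF that x] by (rule has_field_derivative_at_within)
          show "norm (u' z x) \<le> B x" if "z \<in> {a<..<b}" for z using bnd[OF that x] by simp
        qed (use Y t0 in auto)
        then show ?thesis by simp
      qed
      then show ?thesis using Y(1)[of n] by (simp add: s_def abs_divide field_simps)
    qed
    have meas: "u' t0 \<in> borel_measurable M"
      by (rule borel_measurable_LIMSEQ_real[of M s]) (use s_lim s_int in auto)
    have "integrable M (u' t0)"
      by (rule Bochner_Integration.integrable_bound[OF B meas]) (use bnd[OF t0] in force)
    have lim: "(\<lambda>n. \<integral>x. s n x \<partial>M) \<longlonglongrightarrow> (\<integral>x. u' t0 x \<partial>M)"
      by (rule integral_dominated_convergence[where w=B])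
         (use meas s_int B s_lim s_bnd in auto)
    have "(\<integral>x. s n x \<partial>M) = ((\<integral>x. u (t0 + Y n) x \<partial>M) / Y n - (\<integral>x. u t0 x \<partial>M) / Y n)" for n
      unfolding s_def using Y t0 u
      by (simp add: diff_divide_distrib Bochner_Integration.integral_diff)
    then have "(\<lambda>n. (\<integral>x. u (t0 + Y n) x \<partial>M) / Y n - (\<integral>x. u t0 x \<partial>M) / Y n) \<longlonglongrightarrow> (\<integral>x. u' t0 x \<partial>M)"
      using lim by simp
    then show ?thesis
      unfolding Y_def using \<open>integrable M (u' t0)\<close> LIMSEQ_offset[of _ N] by fast
  qed
  show "((\<lambda>t. \<integral>x. u t x \<partial>M) has_real_derivative (\<integral>x. u' t0 x \<partial>M)) (at t0)"
    unfolding DERIV_def tendsto_at_iff_sequentially using * by (auto simp: o_def diff_divide_distrib)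
  \<comment> \<open>Every null sequence yields integrability as a by-product, so one concrete
    sequence suffices.\<close>
  have "(\<lambda>n. 1 / real (Suc n)) \<longlonglongrightarrow> 0" by (rule LIMSEQ_Suc) (rule lim_1_over_n)
  then show "integrable M (u' t0)" using *[of "\<lambda>n. 1 / real (Suc n)"] by simp
qed

text \<open>The rate \<open>a\<close> is a budget: rates add under products, and a measurable
  function is integrable against \<open>gauss\<close> once its rate is below 1/2, the rate of decay
  of the density.\<close>

definition exp_sq_bounded :: "real \<Rightarrow> ('a::real_normed_vector \<Rightarrow> 'b::real_normed_vector) \<Rightarrow> bool" where
  "exp_sq_bounded a g \<longleftrightarrow> (\<exists>K\<ge>0. \<forall>x. norm (g x) \<le> K * exp (a * (norm x)\<^sup>2))"

lemma exp_sq_boundedI: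
  "(\<And>x. norm (g x) \<le> K * exp (a * (norm x)\<^sup>2)) \<Longrightarrow> exp_sq_bounded a g"
  unfolding exp_sq_bounded_def
  by (intro exI[of _ "\<bar>K\<bar>"] conjI allI) (auto intro: order_trans[OF _ mult_right_mono[of K "\<bar>K\<bar>"]])

lemma exp_sq_boundedE:
  assumes "exp_sq_bounded a g"
  obtains K where "K \<ge> 0" "\<And>x. norm (g x) \<le> K * exp (a * (norm x)\<^sup>2)"
  using assms unfolding exp_sq_bounded_def by auto

lemma exp_sq_bounded_le:
  assumes "exp_sq_bounded a g" "\<And>x. norm (k x) \<le> norm (g x)" "a \<le> b"
  shows "exp_sq_bounded b k"
proof -
  obtain K where K: "K \<ge> 0" "\<And>x. norm (g x) \<le> K * exp (a * (norm x)\<^sup>2)"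
    using assms(1) by (rule exp_sq_boundedE) blast
  have "norm (k x) \<le> K * exp (b * (norm x)\<^sup>2)" for x
  proof -
    have "norm (k x) \<le> K * exp (a * (norm x)\<^sup>2)" using assms(2) K(2) order_trans by blast
    also have "\<dots> \<le> K * exp (b * (norm x)\<^sup>2)"
      using K(1) assms(3) by (intro mult_left_mono) (auto intro: mult_right_mono)
    finally show ?thesis .
  qed
  then show ?thesis by (rule exp_sq_boundedI)
qed

lemma exp_sq_bounded_add:
  assumes "exp_sq_bounded a g" "exp_sq_bounded a k"
  shows "exp_sq_bounded a (\<lambda>x. g x + k x)"
proof -
  obtain K L where K: "\<And>x. norm (g x) \<le> K * exp (a * (norm x)\<^sup>2)"
      and L: "\<And>x. norm (k x) \<le> L * exp (a * (norm x)\<^sup>2)"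
    using assms by (meson exp_sq_boundedE)
  show ?thesis
    by (rule exp_sq_boundedI[of _ "K + L"]) (smt (verit) K L norm_triangle_ineq distrib_right)
qed

lemma exp_sq_bounded_mult:
  fixes g k :: "'a::real_normed_vector \<Rightarrow> real"
  assumes "exp_sq_bounded a g" "exp_sq_bounded b k" "a + b \<le> c"
  shows "exp_sq_bounded c (\<lambda>x. g x * k x)"
proof -
  obtain K L where K: "K \<ge> 0" "\<And>x. norm (g x) \<le> K * exp (a * (norm x)\<^sup>2)"
      and L: "L \<ge> 0" "\<And>x. norm (k x) \<le> L * exp (b * (norm x)\<^sup>2)"
    using assms by (meson exp_sq_boundedE)
  have "exp_sq_bounded (a + b) (\<lambda>x. g x * k x)"
  proof (rule exp_sq_boundedI[of _ "K * L"])
    fix x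
    have "norm (g x) * norm (k x) \<le> (K * exp (a * (norm x)\<^sup>2)) * (L * exp (b * (norm x)\<^sup>2))"
      using K L by (intro mult_mono) auto
    then show "norm (g x * k x) \<le> K * L * exp ((a + b) * (norm x)\<^sup>2)"
      by (simp add: norm_mult abs_mult exp_add distrib_right algebra_simps)
  qed
  then show ?thesis by (rule exp_sq_bounded_le) (use assms(3) in auto)
qed

lemma exp_sq_bounded_norm: "exp_sq_bounded a (\<lambda>x. norm (g x)) \<longleftrightarrow> exp_sq_bounded a g"
  by (simp add: exp_sq_bounded_def)

lemma exp_sq_bounded_const: "0 \<le> a \<Longrightarrow> exp_sq_bounded a (\<lambda>_. c)"
  by (rule exp_sq_boundedI[of _ "norm c"]) (simp add: mult_le_cancel_left1)

text \<open>Completing the square: a linear exponent costs an arbitrarily small quadratic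
  rate.\<close>

lemma exp_linear_bound:
  fixes C e :: real
  assumes "e > 0"
  shows "exp (C * r) \<le> exp (C\<^sup>2 / (4 * e)) * exp (e * r\<^sup>2)"
proof -
  have "0 \<le> e * (r - C / (2 * e))\<^sup>2" using assms by simp
  also have "\<dots> = e * r\<^sup>2 - C * r + C\<^sup>2 / (4 * e)"
    using assms by (simp add: power2_diff field_simps) (simp add: power2_eq_square field_simps)
  finally show ?thesis by (simp add: exp_add[symmetric])
qed

lemma exp_sq_bounded_linear:
  assumes "e > 0" "\<And>x. norm (g x) \<le> A + B * norm x"
  shows "exp_sq_bounded e g"
proof (rule exp_sq_boundedI)
  fix x
  have "norm (g x) \<le> (\<bar>A\<bar> + \<bar>B\<bar>) * (1 + norm x)"
    using assms(2)[of x] by (simp add: algebra_simps) (smt (verit) mult_right_mono norm_ge_zero mult_nonneg_nonneg)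
  also have "\<dots> \<le> (\<bar>A\<bar> + \<bar>B\<bar>) * exp (1 * norm x)"
    by (intro mult_left_mono) (auto simp: add.commute)
  also have "\<dots> \<le> (\<bar>A\<bar> + \<bar>B\<bar>) * (exp (1\<^sup>2 / (4 * e)) * exp (e * (norm x)\<^sup>2))"
    by (intro mult_left_mono exp_linear_bound assms) auto
  finally show "norm (g x) \<le> (\<bar>A\<bar> + \<bar>B\<bar>) * exp (1\<^sup>2 / (4 * e)) * exp (e * (norm x)\<^sup>2)"
    by (simp add: mult.assoc)
qed

lemma integrable_gauss_exp_sq_bounded:
  fixes g :: "'a::euclidean_space \<Rightarrow> 'b::{banach, second_countable_topology}"
  assumes "exp_sq_bounded a g" "a < 1/2" "g \<in> borel_measurable borel"
  shows "integrable gauss g"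
proof -
  obtain K where K: "K \<ge> 0" "\<And>x. norm (g x) \<le> K * exp (a * (norm x)\<^sup>2)"
    using assms(1) by (rule exp_sq_boundedE) blast
  show ?thesis
    by (rule Bochner_Integration.integrable_bound[where f="\<lambda>x. K * exp (a * (norm x)\<^sup>2)"])
       (use K assms in \<open>auto intro!: integrable_mult_right integrable_gauss_exp_sq AE_I2 intro: order_trans\<close>)
qed

text \<open>Meant for \<open>T\<close> a projection or the rotated point of a pair of copies:
  passing to the product space costs nothing in the rate.\<close>

lemma exp_sq_bounded_comp:
  assumes "exp_sq_bounded a g" "0 \<le> a" "\<And>z. norm (T z) \<le> norm z"
  shows "exp_sq_bounded a (\<lambda>z. g (T z))"
proof -
  obtain K where K: "K \<ge> 0" "\<And>x. norm (g x) \<le> K * exp (a * (norm x)\<^sup>2)"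
    using assms(1) by (rule exp_sq_boundedE) blast
  show ?thesis
  proof (rule exp_sq_boundedI)
    fix z
    have "norm (g (T z)) \<le> K * exp (a * (norm (T z))\<^sup>2)" by (rule K)
    also have "\<dots> \<le> K * exp (a * (norm z)\<^sup>2)"
      using K(1) assms(2,3) by (intro mult_left_mono) (auto intro!: mult_left_mono power_mono)
    finally show "norm (g (T z)) \<le> K * exp (a * (norm z)\<^sup>2)" .
  qed
qed

lemma exp_sq_bounded_inner:
  fixes g k :: "'a::real_normed_vector \<Rightarrow> 'b::real_inner"
  assumes "exp_sq_bounded a g" "exp_sq_bounded b k" "a + b \<le> c"
  shows "exp_sq_bounded c (\<lambda>x. g x \<bullet> k x)"
  by (rule exp_sq_bounded_le[OF exp_sq_bounded_mult[of a "\<lambda>x. norm (g x)" b "\<lambda>x. norm (k x)", OF _ _ assms(3)]])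
     (use assms in \<open>auto simp: exp_sq_bounded_norm Cauchy_Schwarz_ineq2\<close>)

lemma exp_sq_bounded_cmult:
  fixes g :: "'a::real_normed_vector \<Rightarrow> real"
  assumes "exp_sq_bounded a g"
  shows "exp_sq_bounded a (\<lambda>x. c * g x)"
  by (rule exp_sq_bounded_mult[of 0 _ a, OF exp_sq_bounded_const assms]) auto

text \<open>One integrable majorant for all small shifts. Half of the decay rate \<open>e\<close> is
  given up, because |x|^2 is at most twice the square of the shifted point plus 2 |d|^2.\<close>

lemma gauss_density_shift_bound:
  assumes "exp_sq_bounded a Q" "a < 1/2"
  shows "\<exists>B. integrable lborel B \<and>
    (\<forall>t\<in>{-1<..<1}. \<forall>x. \<bar>gauss_density (x + t *\<^sub>R d) * Q (x + t *\<^sub>R d)\<bar> \<le> B (x::'a::euclidean_space))"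
proof -
  define e where "e = 1/2 - a"
  have e: "e > 0" using assms by (simp add: e_def)
  define N where "N = (1 / sqrt (2 * pi)) ^ DIM('a)"
  have N: "N \<ge> 0" by (simp add: N_def)
  obtain K where K: "K \<ge> 0" "\<And>x. norm (Q x) \<le> K * exp (a * (norm x)\<^sup>2)"
    using assms(1) by (rule exp_sq_boundedE) blast
  define B where "B x = N * K * exp (e * (norm d)\<^sup>2) * exp (- (e / 2) * (norm x)\<^sup>2)" for x :: 'a
  have "integrable lborel B"
    unfolding B_def using e by (intro integrable_mult_right integrable_lborel_exp_sq) auto
  moreover have "\<bar>gauss_density (x + t *\<^sub>R d) * Q (x + t *\<^sub>R d)\<bar> \<le> B x" if t: "t \<in> {-1<..<1}" for t x
  proof -
    define y where "y = x + t *\<^sub>R d"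
    have "norm x \<le> norm y + norm (t *\<^sub>R d)"
      unfolding y_def by (metis add_diff_cancel norm_triangle_ineq4)
    also have "norm (t *\<^sub>R d) \<le> norm d" using t by (auto intro: mult_left_le_one_le)
    finally have "(norm x)\<^sup>2 \<le> (norm y + norm d)\<^sup>2" by (intro power_mono) auto
    also have "\<dots> \<le> 2 * (norm y)\<^sup>2 + 2 * (norm d)\<^sup>2"
      using zero_le_power2[of "norm y - norm d"] by (simp add: power2_sum power2_diff)
    finally have "- e * (norm y)\<^sup>2 \<le> e * (norm d)\<^sup>2 + - (e / 2) * (norm x)\<^sup>2"
      using mult_left_mono[of "(norm x)\<^sup>2" "2 * (norm y)\<^sup>2 + 2 * (norm d)\<^sup>2" "e/2"] e
      by (simp add: algebra_simps)
    then have *: "exp (- e * (norm y)\<^sup>2) \<le> exp (e * (norm d)\<^sup>2) * exp (- (e / 2) * (norm x)\<^sup>2)"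
      by (simp add: exp_add[symmetric])
    have "\<bar>gauss_density y * Q y\<bar> \<le> N * exp (- (norm y)\<^sup>2 / 2) * (K * exp (a * (norm y)\<^sup>2))"
      unfolding abs_mult using K N gauss_density_pos[of y]
      by (auto simp: gauss_density_def N_def intro!: mult_left_mono)
    also have "\<dots> = N * K * exp (- e * (norm y)\<^sup>2)"
      by (simp add: e_def exp_add[symmetric] algebra_simps)
    also have "\<dots> \<le> B x"
      unfolding B_def using N K * by (auto simp: mult.assoc intro!: mult_left_mono)
    finally show ?thesis by (simp add: y_def)
  qed
  ultimately show ?thesis by blast
qed

lemma lborel_shift:
  fixes h :: "'a::euclidean_space \<Rightarrow> real"
  assumes [measurable]: "h \<in> borel_measurable borel"
  shows "integrable lborel (\<lambda>x. h (x + c)) \<longleftrightarrow> integrable lborel h"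
    and "(\<integral>x. h (x + c) \<partial>lborel) = (\<integral>x. h x \<partial>lborel)"
proof -
  have [measurable]: "(+) c \<in> borel_measurable borel" by (intro borel_measurable_continuous_onI continuous_intros)
  have "integrable (distr lborel borel ((+) c)) h \<longleftrightarrow> integrable lborel (\<lambda>x. h (c + x))"
    by (rule integrable_distr_eq) auto
  then show "integrable lborel (\<lambda>x. h (x + c)) \<longleftrightarrow> integrable lborel h"
    by (simp add: lborel_distr_plus add.commute)
  have "(\<integral>x. h x \<partial>distr lborel borel ((+) c)) = (\<integral>x. h (c + x) \<partial>lborel)"
    by (rule integral_distr) auto
  then show "(\<integral>x. h (x + c) \<partial>lborel) = (\<integral>x. h x \<partial>lborel)"
    by (simp add: lborel_distr_plus add.commute)
qed

text \<open>By translation invariance of Lebesgue measure, the integral of density times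
  \<open>P\<close>, both evaluated at \<open>x + t *\<^sub>R d\<close>, does not depend on
  \<open>t\<close>. Its derivative at 0 therefore vanishes, which is the claim. Only a directional
  derivative of \<open>P\<close> is involved.\<close>

lemma gauss_integration_by_parts:
  fixes P P' :: "'a::euclidean_space \<Rightarrow> real"
  assumes a: "a < 1/2" and P [measurable]: "P \<in> borel_measurable borel"
    and der: "\<And>x. ((\<lambda>t. P (x + t *\<^sub>R d)) has_real_derivative P' x) (at 0)"
    and bP: "exp_sq_bounded a P" and bP': "exp_sq_bounded a P'"
  shows "(\<integral>x. P' x \<partial>gauss) = (\<integral>x. (d \<bullet> x) * P x \<partial>gauss)"
proof -
  \<comment> \<open>Room between \<open>a\<close> and 1/2 for the linear factor
    \<open>d \<bullet> x\<close>.\<close>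
  define b where "b = (a + 1/2) / 2"
  have b: "a < b" "b < 1/2" using a by (auto simp: b_def)
  have bdP: "exp_sq_bounded b (\<lambda>y. (d \<bullet> y) * P y)"
    by (rule exp_sq_bounded_mult[OF exp_sq_bounded_linear[of "b - a" _ 0 "norm d"] bP])
       (use b Cauchy_Schwarz_ineq2[of d] in auto)
  define Q where "Q y = P' y + (-1) * ((d \<bullet> y) * P y)" for y
  have bQ: "exp_sq_bounded b Q"
    unfolding Q_def
    by (intro exp_sq_bounded_add exp_sq_bounded_cmult bdP exp_sq_bounded_le[OF bP']) (use b in auto)
  define u where "u t x = gauss_density (x + t *\<^sub>R d) * P (x + t *\<^sub>R d)" for t x
  define u' where "u' t x = gauss_density (x + t *\<^sub>R d) * Q (x + t *\<^sub>R d)" for t x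
  obtain B where B: "integrable lborel B" "\<And>t x. t \<in> {-1<..<1} \<Longrightarrow> \<bar>u' t x\<bar> \<le> B x"
    using gauss_density_shift_bound[OF bQ b(2), of d] unfolding u'_def by blast
  have iP: "integrable lborel (\<lambda>x. gauss_density x * P x)"
    using integrable_gauss_exp_sq_bounded[OF bP a P] by (simp add: integrable_gauss_iff)
  have idP: "integrable gauss (\<lambda>y. (d \<bullet> y) * P y)"
    by (rule integrable_gauss_exp_sq_bounded[OF bdP b(2)]) simp
  have iu: "integrable lborel (u t)" for t
    unfolding u_def using iP by (subst lborel_shift(1)) auto
  have cu: "(\<integral>x. u t x \<partial>lborel) = (\<integral>x. gauss_density x * P x \<partial>lborel)" for t
    unfolding u_def by (subst lborel_shift(2)) auto
  have du: "((\<lambda>t. u t x) has_real_derivative u' t x) (at t)" for t x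
  proof -
    have 1: "((\<lambda>t. P (x + t *\<^sub>R d)) has_real_derivative P' (x + t *\<^sub>R d)) (at t)"
      using der[of "x + t *\<^sub>R d"] DERIV_shift[of "\<lambda>s. P (x + s *\<^sub>R d)" _ 0 t]
      by (simp add: scaleR_add_left add_ac)
    have 2: "((\<lambda>t. gauss_density (x + t *\<^sub>R d)) has_real_derivative
        gauss_density (x + t *\<^sub>R d) * (- (d \<bullet> (x + t *\<^sub>R d)))) (at t)"
      unfolding gauss_density_def power2_norm_eq_inner
      by (auto intro!: derivative_eq_intros simp: inner_simps inner_commute field_simps)
    show ?thesis
      unfolding u_def u'_def Q_def
      by (rule DERIV_cong[OF DERIV_mult[OF 2 1]]) (simp add: algebra_simps)
  qed
  note D = has_real_derivative_lebesgue_integral[of 0 "-1" 1 lborel u u' B, OF _ du B(2) B(1) iu]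
  have iu': "integrable lborel (u' 0)" by (rule D(2)) auto
  have "((\<lambda>t. \<integral>x. u t x \<partial>lborel) has_real_derivative (\<integral>x. u' 0 x \<partial>lborel)) (at 0)" by (rule D(1)) auto
  then have 0: "(\<integral>x. u' 0 x \<partial>lborel) = 0"
    unfolding cu by (metis DERIV_const DERIV_unique)
  \<comment> \<open>Measurability of \<open>P'\<close> is not assumed; it is recovered by dividing
    the measurable \<open>u' 0\<close> by the positive density.\<close>
  have [measurable]: "Q \<in> borel_measurable borel"
  proof -
    have [measurable]: "u' 0 \<in> borel_measurable borel" using iu' by (auto dest: borel_measurable_integrable)
    have "(\<lambda>x. u' 0 x / gauss_density x) \<in> borel_measurable borel" by measurable
    also have "(\<lambda>x. u' 0 x / gauss_density x) = Q"
      by (auto simp: u'_def fun_eq_iff) (metis gauss_density_pos less_irrefl)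
    finally show ?thesis .
  qed
  have iQ: "integrable gauss Q" and Q0: "(\<integral>x. Q x \<partial>gauss) = 0"
    using iu' 0 by (simp_all add: integrable_gauss_iff integral_gauss_eq u'_def[abs_def])
  have P'_eq: "P' = (\<lambda>y. Q y + (d \<bullet> y) * P y)" by (auto simp: Q_def)
  show "(\<integral>x. P' x \<partial>gauss) = (\<integral>x. (d \<bullet> x) * P x \<partial>gauss)"
    unfolding P'_eq using Q0 by (simp add: Bochner_Integration.integral_add[OF iQ idP])
qed

text \<open>The derivative need not be continuous, but each directional derivative is a pointwise
  limit of difference quotients of the continuous \<open>g\<close>.\<close>

lemma borel_measurable_derivative:
  fixes g :: "'a::euclidean_space \<Rightarrow> 'b::euclidean_space"
  assumes "\<And>x. (g has_derivative g' x) (at x)"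
  shows "(\<lambda>x. g' x d) \<in> borel_measurable borel" and "g \<in> borel_measurable borel"
proof -
  have "continuous_on UNIV g"
    using assms by (meson continuous_at_imp_continuous_on has_derivative_continuous)
  then show [measurable]: "g \<in> borel_measurable borel" by (rule borel_measurable_continuous_onI)
  have "(\<lambda>x. g' x d \<bullet> b) \<in> borel_measurable borel" for b
  proof (rule borel_measurable_LIMSEQ_real)
    fix x
    have "((\<lambda>t. g (x + t *\<^sub>R d)) has_derivative (\<lambda>s. g' x (s *\<^sub>R d))) (at 0)"
      by (rule has_derivative_compose[of "\<lambda>t. x + t *\<^sub>R d" "\<lambda>s. s *\<^sub>R d" 0 UNIV g, simplified])
         (auto intro!: derivative_eq_intros assms)
    then have "((\<lambda>t. g (x + t *\<^sub>R d) \<bullet> b) has_derivative (\<lambda>s. g' x (s *\<^sub>R d) \<bullet> b)) (at 0)"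
      by (rule has_derivative_inner_left)
    then have "((\<lambda>t. g (x + t *\<^sub>R d) \<bullet> b) has_real_derivative g' x d \<bullet> b) (at 0)"
      using has_derivative_linear[OF assms, of x]
      by (simp add: has_field_derivative_def linear_scale mult_commute_abs)
    then have "((\<lambda>h. (g (x + h *\<^sub>R d) \<bullet> b - g x \<bullet> b) / h) \<longlongrightarrow> g' x d \<bullet> b) (at 0)"
      by (simp add: DERIV_def)
    then have "((\<lambda>h. (g (x + h *\<^sub>R d) \<bullet> b - g x \<bullet> b) / h) \<circ> (\<lambda>n. 1 / real (Suc n))) \<longlonglongrightarrow> g' x d \<bullet> b"
      using LIMSEQ_Suc[OF lim_1_over_n[where 'a=real]] by (subst (asm) tendsto_at_iff_sequentially) auto
    then show "(\<lambda>n. (g (x + (1 / real (Suc n)) *\<^sub>R d) \<bullet> b - g x \<bullet> b) / (1 / real (Suc n))) \<longlonglongrightarrow> g' x d \<bullet> b"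
      by (simp add: o_def)
  qed measurable
  then show "(\<lambda>x. g' x d) \<in> borel_measurable borel"
    by (subst borel_measurable_euclidean_space) auto
qed

section \<open>Rotation of two independent Gaussian copies\<close>

lemma norm_rotation_le:
  fixes x y :: "'a::real_inner"
  shows "norm (cos t *\<^sub>R x + sin t *\<^sub>R y) \<le> norm (x, y)"
proof (rule power2_le_imp_le)
  have "(cos t)\<^sup>2 * (x \<bullet> x) + (sin t)\<^sup>2 * (x \<bullet> x) = x \<bullet> x" "(cos t)\<^sup>2 * (y \<bullet> y) + (sin t)\<^sup>2 * (y \<bullet> y) = y \<bullet> y"
    by (simp_all add: distrib_right[symmetric])
  \<comment> \<open>The second vector completes the rotation to an isometry of the pair; dropping it
    leaves the inequality.\<close>
  then have "(norm (cos t *\<^sub>R x + sin t *\<^sub>R y))\<^sup>2 + (norm (- sin t *\<^sub>R x + cos t *\<^sub>R y))\<^sup>2 = (norm (x, y))\<^sup>2"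
    unfolding power2_norm_eq_inner
    by (simp add: inner_simps inner_commute power2_eq_square algebra_simps)
  then show "(norm (cos t *\<^sub>R x + sin t *\<^sub>R y))\<^sup>2 \<le> (norm (x, y))\<^sup>2"
    using zero_le_power2[of "norm (- sin t *\<^sub>R x + cos t *\<^sub>R y)"] by linarith
qed simp

text \<open>
  The derivative in \<open>t\<close> produces the weight \<open>- sin t * x + cos t * y\<close>. Along the directions
  \<open>(- sin t * e, cos t * e)\<close> the rotated point \<open>cos t * x + sin t * y\<close> is constant, so integrating
  this weight by parts differentiates only \<open>G\<close>, and \<open>g'\<close> need not be continuous.
\<close>

lemma gauss_rotation_derivative:
  fixes g G :: "'a::euclidean_space \<Rightarrow> 'b::euclidean_space"
  assumes dg: "\<And>x. (g has_derivative g' x) (at x)" and dG: "\<And>x. (G has_derivative G' x) (at x)"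
    and ab: "0 \<le> a" "0 \<le> b" "a + b < 1/2"
    and bg: "exp_sq_bounded a g" "\<And>d. exp_sq_bounded a (\<lambda>x. g' x d)"
    and bG: "exp_sq_bounded b G" "\<And>d. exp_sq_bounded b (\<lambda>x. G' x d)"
  shows "((\<lambda>t. \<integral>z. g (cos t *\<^sub>R fst z + sin t *\<^sub>R snd z) \<bullet> G (fst z) \<partial>gauss) has_real_derivative
      - sin t * (\<integral>z. (\<Sum>e\<in>Basis. g' (cos t *\<^sub>R fst z + sin t *\<^sub>R snd z) e \<bullet> G' (fst z) e) \<partial>gauss)) (at t)"
    (is ?D)
    and "\<And>e. integrable gauss (\<lambda>z. g' (cos t *\<^sub>R fst z + sin t *\<^sub>R snd z) e \<bullet> G' (fst z) e)"
proof -
  define c where "c = (a + b + 1/2) / 2"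
  have c: "a + b < c" "c < 1/2" "0 < c" using ab by (auto simp: c_def)
  define X where "X t z = cos t *\<^sub>R fst z + sin t *\<^sub>R snd z" for t :: real and z :: "'a \<times> 'a"
  define X' where "X' t z = - sin t *\<^sub>R fst z + cos t *\<^sub>R snd z" for t :: real and z :: "'a \<times> 'a"
  have nX: "norm (X t z) \<le> norm z" for t z
    using norm_rotation_le[where x="fst z" and y="snd z"] by (simp add: X_def)
  note [measurable] = borel_measurable_derivative[OF dg] borel_measurable_derivative[OF dG]
  have [measurable]: "X t \<in> borel_measurable borel" for t
    unfolding X_def by (intro borel_measurable_continuous_onI continuous_intros)
  have [measurable]: "(fst :: 'a \<times> 'a \<Rightarrow> 'a) \<in> borel_measurable borel"
    by (intro borel_measurable_continuous_onI continuous_intros)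
  have bgX: "exp_sq_bounded a (\<lambda>z. g (X t z))" "exp_sq_bounded a (\<lambda>z. g' (X t z) d)" for t d
    by (rule exp_sq_bounded_comp[OF bg(1) ab(1) nX], rule exp_sq_bounded_comp[OF bg(2) ab(1) nX])
  have bGX: "exp_sq_bounded b (\<lambda>z::'a \<times> 'a. G (fst z))" "exp_sq_bounded b (\<lambda>z::'a \<times> 'a. G' (fst z) d)" for d
    by (intro exp_sq_bounded_comp[where T=fst, OF bG(1) ab(2)] exp_sq_bounded_comp[where T=fst, OF bG(2) ab(2)];
        simp add: norm_fst_le split_paired_all)+
  have lin: "linear (g' x)" for x using dg has_derivative_linear by blast
  have linG: "linear (G' x)" for x using dG has_derivative_linear by blast
  define u where "u t z = g (X t z) \<bullet> G (fst z)" for t z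
  define P where "P t e z = g' (X t z) e \<bullet> G (fst z)" for t e z
  define P' where "P' t e z = - sin t * (g' (X t z) e \<bullet> G' (fst z) e)" for t e z
  \<comment> \<open>The velocity \<open>X' t z\<close> expanded in the basis: its component along
    \<open>e\<close> is the pairing of \<open>z\<close> with the direction in which integration by
    parts is performed.\<close>
  define u' where "u' t z = (\<Sum>e\<in>Basis. ((- sin t *\<^sub>R e, cos t *\<^sub>R e) \<bullet> z) * P t e z)" for t z
  have bP: "exp_sq_bounded (a + b) (P t e)" for t e
    unfolding P_def by (rule exp_sq_bounded_inner[OF bgX(2) bGX(1)]) simp
  have bP': "exp_sq_bounded (a + b) (P' t e)" for t e
    unfolding P'_def by (intro exp_sq_bounded_cmult exp_sq_bounded_inner[OF bgX(2) bGX(2)]) simp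
  have iu: "integrable gauss (u t)" for t
    by (rule integrable_gauss_exp_sq_bounded[where a="a + b"])
       (use ab in \<open>auto simp: u_def[abs_def] intro!: exp_sq_bounded_inner[OF bgX(1) bGX(1)]\<close>)
  have du: "((\<lambda>t. u t z) has_real_derivative u' t z) (at t)" for t z
  proof -
    have 1: "((\<lambda>t. X t z) has_derivative (\<lambda>s. s *\<^sub>R X' t z)) (at t)"
      unfolding X_def X'_def by (auto intro!: derivative_eq_intros simp: scaleR_add_right scaleR_diff_right)
    have "((\<lambda>t. u t z) has_derivative (\<lambda>s. g' (X t z) (s *\<^sub>R X' t z) \<bullet> G (fst z))) (at t)"
      unfolding u_def by (intro has_derivative_inner_left has_derivative_compose[OF 1] dg)
    then have "((\<lambda>t. u t z) has_real_derivative g' (X t z) (X' t z) \<bullet> G (fst z)) (at t)"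
      by (simp add: has_field_derivative_def linear_scale[OF lin] mult_commute_abs)
    also have "g' (X t z) (X' t z) = (\<Sum>e\<in>Basis. (X' t z \<bullet> e) *\<^sub>R g' (X t z) e)"
      by (subst euclidean_representation[of "X' t z", symmetric])
         (simp only: linear_sum[OF lin] linear_scale[OF lin])
    also have "\<dots> \<bullet> G (fst z) = u' t z"
      unfolding inner_sum_left u'_def
      by (intro sum.cong) (auto simp: X'_def P_def inner_prod_def inner_simps inner_commute)
    finally show ?thesis .
  qed
  \<comment> \<open>The majorant can be uniform in \<open>t\<close>: rotation and projection do not
    increase the norm, and the directions are unit vectors.\<close>
  have "\<exists>B. integrable gauss B \<and> (\<forall>t z. \<bar>u' t z\<bar> \<le> B z)"
  proof -
    obtain L where L: "L \<ge> 0" "\<And>x. norm (G x) \<le> L * exp (b * (norm x)\<^sup>2)"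
      using bG(1) by (rule exp_sq_boundedE) blast
    have "\<forall>e. \<exists>K\<ge>0. \<forall>x. norm (g' x e) \<le> K * exp (a * (norm x)\<^sup>2)"
      using bg(2) by (simp add: exp_sq_bounded_def)
    then obtain K where K: "\<And>e. K e \<ge> 0" "\<And>e x. norm (g' x e) \<le> K e * exp (a * (norm x)\<^sup>2)" by metis
    define B where "B z = (\<Sum>e\<in>(Basis::'a set). K e * L) * (norm z * exp ((a + b) * (norm z)\<^sup>2))" for z :: "'a \<times> 'a"
    have "exp_sq_bounded c B"
      unfolding B_def
      by (intro exp_sq_bounded_cmult exp_sq_bounded_mult[OF exp_sq_bounded_linear[of "c - (a + b)" _ 0 1] exp_sq_boundedI[of _ 1 "a + b"]])
         (use c in auto)
    then have "integrable gauss B"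
      by (rule integrable_gauss_exp_sq_bounded) (use c in \<open>auto simp: B_def[abs_def]\<close>)
    moreover have "\<bar>u' t z\<bar> \<le> B z" for t z
    proof -
      have "\<bar>u' t z\<bar> \<le> (\<Sum>e\<in>(Basis::'a set). (K e * L) * (norm z * exp ((a + b) * (norm z)\<^sup>2)))"
        unfolding u'_def
      proof (rule order_trans[OF sum_abs], rule sum_mono)
        fix e :: 'a assume e: "e \<in> Basis"
        have "norm (- sin t *\<^sub>R e, cos t *\<^sub>R e) = 1"
          using e by (simp add: norm_Pair power_mult_distrib)
        then have 1: "\<bar>(- sin t *\<^sub>R e, cos t *\<^sub>R e) \<bullet> z\<bar> \<le> norm z"
          using Cauchy_Schwarz_ineq2[of "(- sin t *\<^sub>R e, cos t *\<^sub>R e)" z] by simp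
        have "\<bar>P t e z\<bar> \<le> norm (g' (X t z) e) * norm (G (fst z))"
          unfolding P_def by (rule Cauchy_Schwarz_ineq2)
        also have "\<dots> \<le> (K e * exp (a * (norm z)\<^sup>2)) * (L * exp (b * (norm z)\<^sup>2))"
        proof (intro mult_mono)
          show "norm (g' (X t z) e) \<le> K e * exp (a * (norm z)\<^sup>2)"
            by (rule order_trans[OF K(2)]) (intro mult_left_mono iffD2[OF exp_le_cancel_iff] power_mono nX K ab norm_ge_zero)
          show "norm (G (fst z)) \<le> L * exp (b * (norm z)\<^sup>2)"
            by (rule order_trans[OF L(2)]) (intro mult_left_mono iffD2[OF exp_le_cancel_iff] power_mono norm_fst_le[of "fst z" "snd z", unfolded prod.collapse] L ab norm_ge_zero)
        qed (use K in auto)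
        also have "\<dots> = (K e * L) * exp ((a + b) * (norm z)\<^sup>2)"
          by (simp add: exp_add distrib_right)
        finally have 2: "\<bar>P t e z\<bar> \<le> (K e * L) * exp ((a + b) * (norm z)\<^sup>2)" .
        show "\<bar>((- sin t *\<^sub>R e, cos t *\<^sub>R e) \<bullet> z) * P t e z\<bar> \<le> (K e * L) * (norm z * exp ((a + b) * (norm z)\<^sup>2))"
          using mult_mono[OF 1 2] by (simp add: abs_mult mult_ac)
      qed
      also have "\<dots> = B z" by (simp add: B_def sum_distrib_right)
      finally show ?thesis .
    qed
    ultimately show ?thesis by blast
  qed
  then obtain B where B: "integrable gauss B" "\<And>t z. \<bar>u' t z\<bar> \<le> B z" by blast
  have D: "((\<lambda>t. \<integral>z. u t z \<partial>gauss) has_real_derivative (\<integral>z. u' t z \<partial>gauss)) (at t)"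
    by (rule has_real_derivative_lebesgue_integral(1)[of t "t - 1" "t + 1" gauss u u' B]) (use du B iu in auto)
  have ibp: "(\<integral>z. P' t e z \<partial>gauss) = (\<integral>z. ((- sin t *\<^sub>R e, cos t *\<^sub>R e) \<bullet> z) * P t e z \<partial>gauss)" for e
  proof -
    have der: "((\<lambda>s. P t e (z + s *\<^sub>R (- sin t *\<^sub>R e, cos t *\<^sub>R e))) has_real_derivative P' t e z) (at 0)" for z
    proof -
      have "X t (z + s *\<^sub>R (- sin t *\<^sub>R e, cos t *\<^sub>R e)) = X t z" for s
        by (simp add: X_def algebra_simps)
      moreover have "((\<lambda>s. G (fst z - (s * sin t) *\<^sub>R e)) has_derivative (\<lambda>s. G' (fst z) (- (s * sin t) *\<^sub>R e))) (at 0)"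
        by (rule has_derivative_compose[of "\<lambda>s. fst z - (s * sin t) *\<^sub>R e" _ 0 UNIV G, simplified])
           (auto intro!: derivative_eq_intros dG)
      then have "((\<lambda>s. g' (X t z) e \<bullet> G (fst z - (s * sin t) *\<^sub>R e)) has_real_derivative P' t e z) (at 0)"
        unfolding has_field_derivative_def
        by (rule has_derivative_eq_rhs[OF has_derivative_inner_right])
           (simp add: fun_eq_iff P'_def linear_scale[OF linG] linear_neg[OF linG])
      ultimately show ?thesis by (simp add: P_def)
    qed
    have m: "P t e \<in> borel_measurable borel" unfolding P_def by measurable
    show "(\<integral>z. P' t e z \<partial>gauss) = (\<integral>z. ((- sin t *\<^sub>R e, cos t *\<^sub>R e) \<bullet> z) * P t e z \<partial>gauss)"
      by (rule gauss_integration_by_parts[OF ab(3) m der bP bP'])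
  qed
  have idP: "integrable gauss (\<lambda>z. ((- sin t *\<^sub>R e, cos t *\<^sub>R e) \<bullet> z) * P t e z)" for e
  proof (rule integrable_gauss_exp_sq_bounded)
    have "exp_sq_bounded (c - (a + b)) (\<lambda>z. (- sin t *\<^sub>R e, cos t *\<^sub>R e) \<bullet> z)"
      by (rule exp_sq_bounded_linear[of _ _ 0 "norm (- sin t *\<^sub>R e, cos t *\<^sub>R e)"])
         (use c Cauchy_Schwarz_ineq2[of "(- sin t *\<^sub>R e, cos t *\<^sub>R e)"] in simp_all)
    then show "exp_sq_bounded c (\<lambda>z. ((- sin t *\<^sub>R e, cos t *\<^sub>R e) \<bullet> z) * P t e z)"
      by (rule exp_sq_bounded_mult[OF _ bP]) simp
  qed (use c in \<open>auto simp: P_def[abs_def]\<close>)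
  show i2: "integrable gauss (\<lambda>z. g' (cos t *\<^sub>R fst z + sin t *\<^sub>R snd z) e \<bullet> G' (fst z) e)" for e
    unfolding X_def[symmetric]
    by (rule integrable_gauss_exp_sq_bounded[OF exp_sq_bounded_inner[OF bgX(2) bGX(2)], of "a + b"]) (use ab in auto)
  have "(\<integral>z. u' t z \<partial>gauss) = (\<Sum>e\<in>Basis. \<integral>z. ((- sin t *\<^sub>R e, cos t *\<^sub>R e) \<bullet> z) * P t e z \<partial>gauss)"
    unfolding u'_def by (rule Bochner_Integration.integral_sum) (rule idP)
  also have "\<dots> = (\<Sum>e\<in>Basis. - sin t * (\<integral>z. g' (X t z) e \<bullet> G' (fst z) e \<partial>gauss))"
    unfolding ibp[symmetric] P'_def by simp
  also have "\<dots> = - sin t * (\<integral>z. (\<Sum>e\<in>Basis. g' (X t z) e \<bullet> G' (fst z) e) \<partial>gauss)"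
    using i2 by (subst Bochner_Integration.integral_sum) (auto simp: X_def sum_distrib_left sum_negf)
  finally show ?D using D by (simp add: u_def X_def)
qed

lemma exp_sq_bounded_scaleR:
  fixes g :: "'a::real_normed_vector \<Rightarrow> real" and k :: "'a \<Rightarrow> 'b::real_normed_vector"
  assumes "exp_sq_bounded a g" "exp_sq_bounded b k" "a + b \<le> c"
  shows "exp_sq_bounded c (\<lambda>x. g x *\<^sub>R k x)"
  by (rule exp_sq_bounded_le[OF exp_sq_bounded_mult[of a g b "\<lambda>x. norm (k x)", OF _ _ assms(3)]])
     (use assms in \<open>auto simp: exp_sq_bounded_norm\<close>)

text \<open>Evaluates a covariance at the end of the rotation, where the rotated copy is independent
  of the first one.\<close>

lemma gauss_integral_inner_indep:
  fixes p q :: "'a::euclidean_space \<Rightarrow> 'b::euclidean_space"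
  assumes bp: "exp_sq_bounded a p" and bq: "exp_sq_bounded b q"
    and ab: "0 \<le> a" "0 \<le> b" "a + b < 1/2"
    and [measurable]: "p \<in> borel_measurable borel" "q \<in> borel_measurable borel"
  shows "(\<integral>z. p (snd z) \<bullet> q (fst z) \<partial>gauss) = (\<integral>x. p x \<partial>gauss) \<bullet> (\<integral>x. q x \<partial>gauss)"
proof -
  have p: "integrable gauss p" and q: "integrable gauss q"
    by (rule integrable_gauss_exp_sq_bounded[OF bp] integrable_gauss_exp_sq_bounded[OF bq]; use ab in simp)+
  have [measurable]: "(fst :: 'a \<times> 'a \<Rightarrow> 'a) \<in> borel_measurable borel" "(snd :: 'a \<times> 'a \<Rightarrow> 'a) \<in> borel_measurable borel"
    by (intro borel_measurable_continuous_onI continuous_intros)+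
  have pq: "integrable gauss (\<lambda>z. p (snd z) \<bullet> q (fst z))"
    by (rule integrable_gauss_exp_sq_bounded[OF exp_sq_bounded_inner[OF exp_sq_bounded_comp[OF bp ab(1)] exp_sq_bounded_comp[OF bq ab(2)] order_refl] ab(3)])
       (auto simp: norm_fst_le norm_snd_le)
  interpret pair_sigma_finite "gauss :: 'a measure" "gauss :: 'a measure" ..
  have "(\<integral>z. p (snd z) \<bullet> q (fst z) \<partial>gauss) = (\<integral>x. \<integral>y. p y \<bullet> q x \<partial>gauss \<partial>gauss)"
    using integral_fst'[of "\<lambda>z. p (snd z) \<bullet> q (fst z)"] pq by (simp add: gauss_pair)
  also have "\<dots> = (\<integral>x. (\<integral>y. p y \<partial>gauss) \<bullet> q x \<partial>gauss)"
    using p by simp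
  also have "\<dots> = (\<integral>x. p x \<partial>gauss) \<bullet> (\<integral>x. q x \<partial>gauss)"
    using q by simp
  finally show ?thesis .
qed

lemma gauss_integral_fst:
  fixes p :: "'a::euclidean_space \<Rightarrow> real"
  assumes "integrable gauss p"
  shows "(\<integral>z. p (fst z) \<partial>(gauss :: ('a \<times> 'a) measure)) = (\<integral>x. p x \<partial>gauss)"
    and "integrable (gauss :: ('a \<times> 'a) measure) (\<lambda>z. p (fst z))"
proof -
  have d: "distr (gauss :: ('a \<times> 'a) measure) gauss fst = gauss"
    unfolding gauss_pair by (rule gauss.distr_pair_fst)
  have m: "fst \<in> measurable (gauss :: ('a \<times> 'a) measure) gauss"
    unfolding gauss_pair by simp
  have [measurable]: "p \<in> borel_measurable gauss" using assms by (rule borel_measurable_integrable)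
  show "(\<integral>z. p (fst z) \<partial>(gauss :: ('a \<times> 'a) measure)) = (\<integral>x. p x \<partial>gauss)"
    using integral_distr[OF m, of p] by (simp add: d)
  show "integrable (gauss :: ('a \<times> 'a) measure) (\<lambda>z. p (fst z))"
    using integrable_distr_eq[OF m, of p] assms by (simp add: d)
qed

text \<open>A monotonicity argument in place of integrating \<open>sin t * k t\<close>, so no
  regularity of \<open>k\<close> in \<open>t\<close> is required. The \<open>L\<close>-term serves
  the case where the bound on \<open>k\<close> is itself the outcome of a rotation.\<close>

lemma cos_comparison:
  fixes p k :: "real \<Rightarrow> real"
  assumes der: "\<And>t. (p has_real_derivative - sin t * k t) (at t)"
    and k: "\<And>t. 0 \<le> t \<Longrightarrow> t \<le> pi / 2 \<Longrightarrow> k t \<le> K + L * cos t"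
    and t: "0 \<le> t" "t \<le> pi / 2"
  shows "p t \<le> p (pi / 2) + K * cos t + L * (cos t)\<^sup>2 / 2"
proof -
  define r where "r t = p t - K * cos t - L * (cos t)\<^sup>2 / 2" for t
  have "r t \<le> r (pi / 2)"
  proof (rule DERIV_nonneg_imp_nondecreasing[OF t(2)])
    fix s assume s: "t \<le> s" "s \<le> pi / 2"
    have "(r has_real_derivative sin s * (K + L * cos s - k s)) (at s)"
      unfolding r_def by (auto intro!: derivative_eq_intros der simp: field_simps)
    moreover have "sin s * (K + L * cos s - k s) \<ge> 0"
      using s t k[of s] by (intro mult_nonneg_nonneg sin_ge_zero) auto
    ultimately show "\<exists>y. (r has_real_derivative y) (at s) \<and> 0 \<le> y" by blast
  qed
  then show ?thesis by (simp add: r_def)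
qed

section \<open>Functions with bounded Hessian\<close>

text \<open>Coordinate-free setting, used for \<open>f\<close>, for the centred \<open>f\<close> and
  for its negative; the entries \<open>l i k\<close> enter only through the value of
  \<open>h\<close>.\<close>

locale hessian_bounded =
  fixes f :: "'a::euclidean_space \<Rightarrow> real" and v :: "'a \<Rightarrow> 'a" and H :: "'a \<Rightarrow> 'a \<Rightarrow> 'a" and h :: real
  assumes df: "\<And>x. (f has_derivative (\<lambda>d. v x \<bullet> d)) (at x)"
    and dv: "\<And>x. (v has_derivative H x) (at x)"
    and h: "0 \<le> h"
    and hilbert_schmidt: "\<And>x. (\<Sum>e\<in>Basis. (norm (H x e))\<^sup>2) \<le> h\<^sup>2"
begin

lemma linear_H: "linear (H x)"
  using dv has_derivative_linear by blast

lemma H_eq: "H x d = (\<Sum>e\<in>Basis. (d \<bullet> e) *\<^sub>R H x e)"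
  by (subst euclidean_representation[of d, symmetric])
     (simp only: linear_sum[OF linear_H] linear_scale[OF linear_H])

text \<open>Cauchy-Schwarz over the basis: the Hilbert-Schmidt norm dominates the operator
  norm.\<close>

lemma norm_H_le: "norm (H x d) \<le> h * norm d"
proof -
  have "norm (H x d) \<le> (\<Sum>e\<in>Basis. \<bar>d \<bullet> e\<bar> * norm (H x e))"
    by (subst H_eq) (rule order_trans[OF norm_sum], simp)
  also have "\<dots> \<le> norm d * h"
  proof (rule power2_le_imp_le)
    have "(\<Sum>e\<in>Basis. \<bar>d \<bullet> e\<bar> * norm (H x e))\<^sup>2 \<le> (\<Sum>e\<in>Basis. \<bar>d \<bullet> e\<bar>\<^sup>2) * (\<Sum>e\<in>Basis. (norm (H x e))\<^sup>2)"
      by (rule Cauchy_Schwarz_ineq_sum)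
    also have "\<dots> \<le> (norm d)\<^sup>2 * h\<^sup>2"
      unfolding norm_sq_sum_Basis[of d] power2_abs
      by (intro mult_left_mono hilbert_schmidt sum_nonneg) auto
    finally show "(\<Sum>e\<in>Basis. \<bar>d \<bullet> e\<bar> * norm (H x e))\<^sup>2 \<le> (norm d * h)\<^sup>2"
      by (simp add: power_mult_distrib)
  qed (use h in auto)
  finally show ?thesis by (simp add: mult.commute)
qed

lemma inner_H_le: "(\<Sum>e\<in>Basis. H x e \<bullet> H y e) \<le> h\<^sup>2"
proof -
  have "2 * (H x e \<bullet> H y e) \<le> (norm (H x e))\<^sup>2 + (norm (H y e))\<^sup>2" for e
    using norm_cauchy_schwarz[of "H x e" "H y e"] zero_le_power2[of "norm (H x e) - norm (H y e)"]
    by (simp add: power2_diff)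
  then have "(\<Sum>e\<in>Basis. 2 * (H x e \<bullet> H y e)) \<le> (\<Sum>e\<in>Basis. (norm (H x e))\<^sup>2 + (norm (H y e))\<^sup>2)"
    by (rule sum_mono)
  also have "\<dots> \<le> h\<^sup>2 + h\<^sup>2"
    unfolding sum.distrib by (intro add_mono hilbert_schmidt)
  finally show ?thesis by (simp flip: sum_distrib_left)
qed

lemma norm_v_le: "norm (v x) \<le> norm (v 0) + h * norm x"
proof -
  have "norm (v x - v 0) \<le> h * norm (x - 0)"
  proof (rule differentiable_bound[of UNIV v H])
    show "onorm (H z) \<le> h" for z by (rule onorm_le) (rule norm_H_le)
  qed (use dv in auto)
  then show ?thesis using norm_triangle_ineq2[of "v x" "v 0"] by simp
qed

text \<open>The gradient bound integrated along the segment from 0 to \<open>x\<close>, with a sign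
  \<open>s\<close> treating both directions at once. The coefficient \<open>h / 2\<close> matters:
  it makes exponential moments available in the whole range s h < 1.\<close>

lemma abs_f_le: "\<bar>f x\<bar> \<le> \<bar>f 0\<bar> + norm (v 0) * norm x + h / 2 * (norm x)\<^sup>2"
proof -
  have le: "s * (f x - f 0) \<le> norm (v 0) * norm x + h / 2 * (norm x)\<^sup>2" if s: "\<bar>s\<bar> = 1" for s
  proof -
    define r where "r t = s * f (t *\<^sub>R x) - (t * (norm (v 0) * norm x) + h / 2 * t\<^sup>2 * (norm x)\<^sup>2)" for t
    have "r 1 \<le> r 0"
    proof (rule DERIV_nonpos_imp_nonincreasing[of 0 1 r])
      fix t :: real assume t: "0 \<le> t" "t \<le> 1"
      have "((\<lambda>t. f (t *\<^sub>R x)) has_derivative (\<lambda>c. v (t *\<^sub>R x) \<bullet> (c *\<^sub>R x))) (at t)"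
        by (rule has_derivative_compose[OF _ df]) (auto intro!: derivative_eq_intros)
      then have *: "((\<lambda>t. f (t *\<^sub>R x)) has_real_derivative v (t *\<^sub>R x) \<bullet> x) (at t)"
        by (simp add: has_field_derivative_def mult_commute_abs)
      have "(r has_real_derivative s * (v (t *\<^sub>R x) \<bullet> x) - (norm (v 0) * norm x + h * t * (norm x)\<^sup>2)) (at t)"
        unfolding r_def by (auto intro!: derivative_eq_intros * simp: field_simps)
      moreover have "s * (v (t *\<^sub>R x) \<bullet> x) \<le> \<bar>v (t *\<^sub>R x) \<bullet> x\<bar>"
        using s by (metis abs_ge_self abs_mult mult_1)
      moreover have "\<bar>v (t *\<^sub>R x) \<bullet> x\<bar> \<le> (norm (v 0) + h * (t * norm x)) * norm x"
        using t by (intro order_trans[OF Cauchy_Schwarz_ineq2] mult_right_mono order_trans[OF norm_v_le]) auto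
      ultimately show "\<exists>y. (r has_real_derivative y) (at t) \<and> y \<le> 0"
        by (intro exI conjI) (assumption, simp add: algebra_simps power2_eq_square)
    qed simp
    then show ?thesis by (simp add: r_def algebra_simps)
  qed
  show ?thesis using le[of 1] le[of "-1"] by (simp add: abs_if split: if_splits)
qed

lemma exp_sq_bounded_v: "0 < e \<Longrightarrow> exp_sq_bounded e v"
  by (rule exp_sq_bounded_linear) (auto intro: norm_v_le)

lemma exp_sq_bounded_f:
  assumes "0 < e" shows "exp_sq_bounded e f"
proof -
  have 1: "exp_sq_bounded (e/2) (\<lambda>x::'a. norm x)"
    by (rule exp_sq_bounded_linear[of _ _ 0 1]) (use assms in auto)
  have "exp_sq_bounded e (\<lambda>x::'a. (\<bar>f 0\<bar> + norm (v 0) * norm x) + (h/2) * (norm x * norm x))"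
    by (intro exp_sq_bounded_add[OF exp_sq_bounded_linear[of _ _ "\<bar>f 0\<bar>" "norm (v 0)"]] exp_sq_bounded_cmult exp_sq_bounded_mult[OF 1 1])
       (use assms in auto)
  then show ?thesis
    by (rule exp_sq_bounded_le)
       (use abs_f_le h in \<open>auto simp: power2_eq_square intro: order_trans[OF _ abs_ge_self]\<close>)
qed

text \<open>The quadratic part of \<open>f\<close> gives the rate
  \<open>\<bar>s\<bar> * h / 2\<close>, and the linear part is absorbed in the gap to
  \<open>b\<close>. A rate below 1/2 can be chosen exactly when
  \<open>\<bar>s\<bar> * h < 1\<close>.\<close>

lemma exp_sq_bounded_exp_f:
  assumes "\<bar>s\<bar> * h / 2 < b" shows "exp_sq_bounded b (\<lambda>x. exp (s * f x))"
proof (rule exp_sq_boundedI)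
  fix x
  define e where "e = b - \<bar>s\<bar> * h / 2"
  have e: "e > 0" using assms by (simp add: e_def)
  have "s * f x \<le> \<bar>s\<bar> * (\<bar>f 0\<bar> + norm (v 0) * norm x + h / 2 * (norm x)\<^sup>2)"
    using mult_left_mono[OF abs_f_le[of x], of "\<bar>s\<bar>"] abs_ge_self[of "s * f x"] by (simp add: abs_mult)
  then have "exp (s * f x) \<le> exp (\<bar>s\<bar> * \<bar>f 0\<bar>) * exp ((\<bar>s\<bar> * norm (v 0)) * norm x) * exp (\<bar>s\<bar> * h / 2 * (norm x)\<^sup>2)"
    by (simp add: exp_add[symmetric] algebra_simps)
  also have "\<dots> \<le> exp (\<bar>s\<bar> * \<bar>f 0\<bar>) * (exp ((\<bar>s\<bar> * norm (v 0))\<^sup>2 / (4 * e)) * exp (e * (norm x)\<^sup>2)) * exp (\<bar>s\<bar> * h / 2 * (norm x)\<^sup>2)"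
    by (intro mult_right_mono mult_left_mono exp_linear_bound e) auto
  also have "\<dots> = exp (\<bar>s\<bar> * \<bar>f 0\<bar>) * exp ((\<bar>s\<bar> * norm (v 0))\<^sup>2 / (4 * e)) * exp (b * (norm x)\<^sup>2)"
    by (simp add: e_def exp_add[symmetric] algebra_simps)
  finally show "norm (exp (s * f x)) \<le> exp (\<bar>s\<bar> * \<bar>f 0\<bar>) * exp ((\<bar>s\<bar> * norm (v 0))\<^sup>2 / (4 * e)) * exp (b * (norm x)\<^sup>2)"
    by simp
qed

lemma exp_sq_bounded_H: "0 \<le> e \<Longrightarrow> exp_sq_bounded e (\<lambda>x. H x d)"
  by (rule exp_sq_bounded_le[OF exp_sq_bounded_const[of e "h * norm d"]])
     (use norm_H_le in \<open>auto intro: order_trans[OF _ abs_ge_self]\<close>)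

lemma f_measurable [measurable]: "f \<in> borel_measurable borel"
  and v_measurable [measurable]: "v \<in> borel_measurable borel"
  and H_measurable [measurable]: "(\<lambda>x. H x d) \<in> borel_measurable borel"
  using borel_measurable_derivative[OF df] borel_measurable_derivative[OF dv] by auto

lemma integrable_v: "integrable gauss v"
  by (rule integrable_gauss_exp_sq_bounded[of "1/4"]) (auto simp: exp_sq_bounded_v)

lemma integrable_f: "integrable gauss f"
  by (rule integrable_gauss_exp_sq_bounded[of "1/4"]) (auto simp: exp_sq_bounded_f)

text \<open>Integration by parts in the direction \<open>m\<close> shows that both
  E[(m \<bullet> x) f] and E[(m \<bullet> x)^2] equal |m|^2; then expand 0 \<le>
  E[(f - m \<bullet> x)^2].\<close>

lemma norm_mean_gradient_le_variance:
  assumes "(\<integral>x. f x \<partial>gauss) = 0"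
  shows "(norm (\<integral>x. v x \<partial>gauss))\<^sup>2 \<le> (\<integral>x. (f x)\<^sup>2 \<partial>gauss)"
proof -
  define m where "m = (\<integral>x. v x \<partial>gauss)"
  have bm: "exp_sq_bounded (1/8) (\<lambda>x. m \<bullet> x)"
    by (rule exp_sq_bounded_linear[of _ _ 0 "norm m"]) (auto simp: Cauchy_Schwarz_ineq2)
  have bf: "exp_sq_bounded (1/8) f" by (rule exp_sq_bounded_f) simp
  note i = integrable_gauss_exp_sq_bounded[OF exp_sq_bounded_mult[where c="1/4"]]
  have int: "integrable gauss (\<lambda>x. f x * f x)" "integrable gauss (\<lambda>x. (m \<bullet> x) * f x)"
      "integrable gauss (\<lambda>x. (m \<bullet> x) * (m \<bullet> x))"
    by (rule i[OF bf bf] i[OF bm bf] i[OF bm bm]; simp)+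
  have "(\<integral>x. v x \<bullet> m \<partial>gauss) = (\<integral>x. (m \<bullet> x) * f x \<partial>gauss)"
  proof (rule gauss_integration_by_parts[of "1/4"])
    show "((\<lambda>t. f (x + t *\<^sub>R m)) has_real_derivative v x \<bullet> m) (at 0)" for x
    proof -
      have "((\<lambda>t. f (x + t *\<^sub>R m)) has_derivative (\<lambda>t. v x \<bullet> (t *\<^sub>R m))) (at 0)"
        by (rule has_derivative_compose[of "\<lambda>t. x + t *\<^sub>R m" _ 0 UNIV f, simplified])
           (auto intro!: derivative_eq_intros df)
      then show ?thesis by (simp add: has_field_derivative_def mult_commute_abs)
    qed
    show "exp_sq_bounded (1/4) (\<lambda>x. v x \<bullet> m)"
      by (rule exp_sq_bounded_inner[of "1/8" _ "1/8"]) (auto intro: exp_sq_bounded_v exp_sq_bounded_const)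
  qed (auto intro: exp_sq_bounded_f)
  then have 1: "(\<integral>x. (m \<bullet> x) * f x \<partial>gauss) = m \<bullet> m"
    using integrable_v by (simp add: m_def)
  have "(\<integral>x. m \<bullet> m \<partial>(gauss :: 'a measure)) = (\<integral>x. (m \<bullet> x) * (m \<bullet> x) \<partial>(gauss :: 'a measure))"
  proof (rule gauss_integration_by_parts[of "1/8"])
    show "((\<lambda>t. m \<bullet> (x + t *\<^sub>R m)) has_real_derivative m \<bullet> m) (at 0)" for x
      by (auto intro!: derivative_eq_intros simp: inner_simps)
  qed (auto intro: exp_sq_bounded_const bm)
  then have 2: "(\<integral>x. (m \<bullet> x) * (m \<bullet> x) \<partial>(gauss :: 'a measure)) = m \<bullet> m"
    by (simp add: gauss.prob_space[unfolded space_gauss])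
  have "0 \<le> (\<integral>x. (f x - m \<bullet> x)\<^sup>2 \<partial>gauss)" by simp
  also have "(\<lambda>x. (f x - m \<bullet> x)\<^sup>2) = (\<lambda>x. f x * f x - 2 * ((m \<bullet> x) * f x) + (m \<bullet> x) * (m \<bullet> x))"
    by (auto simp: power2_eq_square algebra_simps)
  also have "(\<integral>x. (f x * f x - 2 * ((m \<bullet> x) * f x) + (m \<bullet> x) * (m \<bullet> x)) \<partial>gauss)
      = (\<integral>x. f x * f x \<partial>gauss) - 2 * (m \<bullet> m) + m \<bullet> m"
    using int by (simp add: 1 2)
  finally have "m \<bullet> m \<le> (\<integral>x. f x * f x \<partial>gauss)" by simp
  then show ?thesis by (simp only: m_def power2_norm_eq_inner power2_eq_square[of "f _"])
qed

end

section \<open>Covariances under the exponential tilt\<close>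

context hessian_bounded begin

lemma has_derivative_exp_f:
  "((\<lambda>x. exp (s * f x)) has_derivative (\<lambda>d. s * (v x \<bullet> d) * exp (s * f x))) (at x)"
  by (rule has_derivative_eq_rhs[OF has_derivative_exp[OF has_derivative_mult_right[OF df]]]) (auto simp: fun_eq_iff)

text \<open>
  Each of the three bounds is a covariance, computed by rotating one of two independent
  Gaussian copies from \<open>0\<close> to \<open>pi / 2\<close>; the third one uses the second one at every angle.
\<close>

lemma
  assumes s: "0 \<le> s" "s * h < 1"
  defines "w \<equiv> \<lambda>x. exp (s * f x)"
  defines "m \<equiv> \<integral>x. v x \<partial>gauss"
  defines "A \<equiv> \<integral>x. w x \<partial>gauss"
  defines "N \<equiv> \<integral>x. (m \<bullet> v x) * w x \<partial>gauss"
  defines "Q \<equiv> \<integral>x. (norm (v x))\<^sup>2 * w x \<partial>gauss"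
  shows tilted_gradient: "N \<le> (norm m)\<^sup>2 * A
      + (s * h) * ((norm m)\<^sup>2 / (2 * (1 - s * h)) * A + (1 - s * h) / 2 * Q)"
    and tilted_gradient_sq: "Q \<le> N + (h\<^sup>2 * A + s * h * Q)"
    and tilted_mean: "(\<integral>x. f x \<partial>gauss) = 0 \<Longrightarrow>
      (\<integral>x. f x * w x \<partial>gauss) \<le> s * (N + (h\<^sup>2 * A + s * h * Q) / 2)"
proof -
  define y where "y = s * h"
  have y: "0 \<le> y" "y < 1" using s h by (auto simp: y_def)
  \<comment> \<open>Budget of growth rates: \<open>w\<close> takes y/2 + \<epsilon> and each factor
    \<open>v\<close> takes \<epsilon>, so the derivative of \<open>w * v\<close>, with two such
    factors, fits into \<open>b\<close>. The total \<epsilon> + b = y/2 + (1 - y)/4 is below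
    1/2.\<close>
  define \<epsilon> where "\<epsilon> = (1 - y) / 20"
  have \<epsilon>: "\<epsilon> > 0" using y by (simp add: \<epsilon>_def)
  define b where "b = y / 2 + 4 * \<epsilon>"
  have b: "0 \<le> b" "\<epsilon> + b < 1/2" using y by (auto simp: b_def \<epsilon>_def field_simps)
  have w_pos: "w x > 0" for x by (simp add: w_def)
  have bw: "exp_sq_bounded (y / 2 + \<epsilon>) w"
    unfolding w_def by (rule exp_sq_bounded_exp_f) (use \<epsilon> s in \<open>simp add: y_def\<close>)
  have bw': "exp_sq_bounded b w"
    by (rule exp_sq_bounded_le[OF bw]) (use \<epsilon> in \<open>auto simp: b_def\<close>)
  note bv = exp_sq_bounded_v[OF \<epsilon>] and bf = exp_sq_bounded_f[OF \<epsilon>]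
  have bvd: "exp_sq_bounded \<epsilon> (\<lambda>x. v x \<bullet> d)" for d
    by (rule exp_sq_bounded_inner[of \<epsilon> _ 0]) (auto intro: bv exp_sq_bounded_const)
  have bH: "exp_sq_bounded e (\<lambda>x. H x d)" if "0 \<le> e" for e d
    using that by (rule exp_sq_bounded_H)
  have [measurable]: "w \<in> borel_measurable borel" unfolding w_def by measurable
  have dw: "(w has_derivative (\<lambda>d. s * (v x \<bullet> d) * w x)) (at x)" for x
    unfolding w_def by (rule has_derivative_exp_f)
  have bdw: "exp_sq_bounded (y / 2 + 2 * \<epsilon>) (\<lambda>x. s * (v x \<bullet> d) * w x)" for d
    by (rule exp_sq_bounded_mult[OF exp_sq_bounded_cmult[OF bvd] bw]) simp
  have bdw': "exp_sq_bounded b (\<lambda>x. s * (v x \<bullet> d) * w x)" for d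
    by (rule exp_sq_bounded_le[OF bdw]) (use \<epsilon> in \<open>auto simp: b_def\<close>)
  have iw: "integrable gauss w"
    by (rule integrable_gauss_exp_sq_bounded[OF bw']) (use b \<epsilon> in auto)
  have bwv: "exp_sq_bounded b (\<lambda>x. w x *\<^sub>R v x)"
    by (rule exp_sq_bounded_scaleR[OF bw bv]) (use \<epsilon> in \<open>simp add: b_def\<close>)
  have iwv: "integrable gauss (\<lambda>x. w x *\<^sub>R v x)"
    by (rule integrable_gauss_exp_sq_bounded[OF bwv]) (use b \<epsilon> in auto)
  have iQ: "integrable gauss (\<lambda>x. (norm (v x))\<^sup>2 * w x)"
  proof (rule integrable_gauss_exp_sq_bounded[of b])
    have "exp_sq_bounded (2 * \<epsilon>) (\<lambda>x. norm (v x) * norm (v x))"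
      by (rule exp_sq_bounded_mult[of \<epsilon> _ \<epsilon>]) (auto simp: exp_sq_bounded_norm bv)
    then show "exp_sq_bounded b (\<lambda>x. (norm (v x))\<^sup>2 * w x)"
      unfolding power2_eq_square by (rule exp_sq_bounded_mult[OF _ bw]) (use \<epsilon> in \<open>simp add: b_def\<close>)
  qed (use b \<epsilon> in auto)
  note iw_fst = gauss_integral_fst[OF iw] and iQ_fst = gauss_integral_fst[OF iQ]
  define X where "X t z = cos t *\<^sub>R fst z + sin t *\<^sub>R snd z" for t :: real and z :: "'a \<times> 'a"
  have X0: "X 0 z = fst z" "X (pi / 2) z = snd z" for z by (simp_all add: X_def)
  have N_eq: "N = m \<bullet> (\<integral>x. w x *\<^sub>R v x \<partial>gauss)"
    unfolding N_def using iwv by (simp add: integral_inner_right[symmetric] mult.commute)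
  have bound_v: "v u \<bullet> H z (v u) \<le> h * (norm (v u))\<^sup>2" for u z
    using norm_cauchy_schwarz[of "v u" "H z (v u)"] mult_left_mono[OF norm_H_le[of z "v u"], of "norm (v u)"]
    by (simp add: power2_eq_square mult_ac)

  show "N \<le> (norm m)\<^sup>2 * A + (s * h) * ((norm m)\<^sup>2 / (2 * (1 - s * h)) * A + (1 - s * h) / 2 * Q)"
  proof -
    define p where "p t = (\<integral>z. (m \<bullet> v (X t z)) \<bullet> w (fst z) \<partial>gauss)" for t
    define K where "K t z = (\<Sum>e\<in>Basis. (m \<bullet> H (X t z) e) \<bullet> (s * (v (fst z) \<bullet> e) * w (fst z)))" for t z
    have bmv: "exp_sq_bounded \<epsilon> (\<lambda>x. m \<bullet> v x)" using bvd[of m] by (simp add: inner_commute)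
    have bmH: "exp_sq_bounded \<epsilon> (\<lambda>x. m \<bullet> H x d)" for d
      by (rule exp_sq_bounded_inner[of 0 _ \<epsilon>]) (use \<epsilon> in \<open>auto intro: bH exp_sq_bounded_const\<close>)
    have dmv: "((\<lambda>x. m \<bullet> v x) has_derivative (\<lambda>d. m \<bullet> H x d)) (at x)" for x
      by (rule has_derivative_inner_right[OF dv])
    note R = gauss_rotation_derivative[OF dmv dw _ b bmv bmH bw' bdw']
    have D: "(p has_real_derivative - sin t * (\<integral>z. K t z \<partial>gauss)) (at t)" for t
      unfolding p_def[abs_def] X_def K_def by (rule R(1)) (use \<epsilon> in simp)
    have I: "integrable gauss (\<lambda>z. (m \<bullet> H (X t z) e) \<bullet> (s * (v (fst z) \<bullet> e) * w (fst z)))" for t e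
      unfolding X_def by (rule R(2)) (use \<epsilon> in simp)
    have le: "K t z \<le> y * ((norm m)\<^sup>2 / (2 * (1 - y)) * w (fst z) + (1 - y) / 2 * ((norm (v (fst z)))\<^sup>2 * w (fst z)))" for t z
    proof -
      let ?v = "v (fst z)"
      have "K t z = (s * w (fst z)) * (m \<bullet> H (X t z) ?v)"
        unfolding K_def H_eq[of _ ?v] inner_sum_right sum_distrib_left
        by (intro sum.cong) auto
      also have "\<dots> \<le> (s * w (fst z)) * (norm m * (h * norm ?v))"
        using s w_pos[of "fst z"]
        by (intro mult_left_mono order_trans[OF norm_cauchy_schwarz mult_left_mono[OF norm_H_le]]) auto
      also have "(s * w (fst z)) * (norm m * (h * norm ?v)) = w (fst z) * (y * (norm m * norm ?v))"
        by (simp add: y_def)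
      also have "\<dots> \<le> w (fst z) * (y * ((norm m)\<^sup>2 / (2 * (1 - y)) + (1 - y) / 2 * (norm ?v)\<^sup>2))"
      proof (intro mult_left_mono)
        \<comment> \<open>Young's inequality with weight \<open>1 - y\<close>, which makes the
          resulting \<open>Q\<close>-term a multiple of the \<open>(1 - y) * Q\<close> that remains
          when the bound on \<open>Q\<close> is solved for \<open>Q\<close>.\<close>
        have "0 \<le> (norm m - (1 - y) * norm ?v)\<^sup>2 / (2 * (1 - y))" using y by simp
        also have "\<dots> = (norm m)\<^sup>2 / (2 * (1 - y)) + (1 - y) / 2 * (norm ?v)\<^sup>2 - norm m * norm ?v"
          using y by (simp add: power2_diff field_simps) (simp add: power2_eq_square algebra_simps)
        finally show "norm m * norm ?v \<le> (norm m)\<^sup>2 / (2 * (1 - y)) + (1 - y) / 2 * (norm ?v)\<^sup>2" by simp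
      qed (use y w_pos[of "fst z"] in auto)
      finally show ?thesis by (simp add: algebra_simps)
    qed
    have le': "(\<integral>z. K t z \<partial>gauss) \<le> y * ((norm m)\<^sup>2 / (2 * (1 - y)) * A + (1 - y) / 2 * Q) + 0 * cos t" for t
    proof -
      have "(\<integral>z. K t z \<partial>gauss) \<le> (\<integral>z. y * ((norm m)\<^sup>2 / (2 * (1 - y)) * w (fst z) + (1 - y) / 2 * ((norm (v (fst z)))\<^sup>2 * w (fst z))) \<partial>(gauss :: ('a \<times> 'a) measure))"
        unfolding K_def
        by (intro integral_mono Bochner_Integration.integrable_sum I integrable_mult_right Bochner_Integration.integrable_add iw_fst(2) iQ_fst(2) le[unfolded K_def])
      also have "\<dots> = y * ((norm m)\<^sup>2 / (2 * (1 - y)) * A + (1 - y) / 2 * Q)"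
        using iw_fst iQ_fst by (simp add: A_def Q_def)
      finally show ?thesis by simp
    qed
    have "p 0 \<le> p (pi / 2) + y * ((norm m)\<^sup>2 / (2 * (1 - y)) * A + (1 - y) / 2 * Q) * cos 0 + 0 * (cos 0)\<^sup>2 / 2"
      by (rule cos_comparison[OF D le']) auto
    moreover have "p 0 = N"
    proof -
      have "integrable gauss (\<lambda>x. (m \<bullet> v x) * w x)"
        using integrable_inner_right[OF iwv, of m] by (simp add: mult.commute)
      from gauss_integral_fst(1)[OF this] show ?thesis by (simp add: p_def X0 N_def)
    qed
    moreover have "p (pi / 2) = (norm m)\<^sup>2 * A"
    proof -
      have "p (pi / 2) = (\<integral>x. m \<bullet> v x \<partial>gauss) \<bullet> A"
        unfolding p_def X0 A_def
        by (rule gauss_integral_inner_indep[OF bmv bw' _ b]) (use \<epsilon> in auto)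
      then show ?thesis using integrable_v by (simp add: m_def power2_norm_eq_inner)
    qed
    ultimately show ?thesis by (simp add: y_def)
  qed

  \<comment> \<open>Runs from \<open>Q\<close> at angle 0 to \<open>N\<close> at angle
    \<open>pi / 2\<close>.\<close>
  define q where "q t = (\<integral>z. v (X t z) \<bullet> (w (fst z) *\<^sub>R v (fst z)) \<partial>gauss)" for t
  have q_le: "q t \<le> N + (h\<^sup>2 * A + y * Q) * cos t" if t: "0 \<le> t" "t \<le> pi / 2" for t
  proof -
    define G' where "G' x d = w x *\<^sub>R H x d + (s * (v x \<bullet> d) * w x) *\<^sub>R v x" for x d
    define K where "K t z = (\<Sum>e\<in>Basis. H (X t z) e \<bullet> G' (fst z) e)" for t z
    have dG: "((\<lambda>x. w x *\<^sub>R v x) has_derivative G' x) (at x)" for x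
      unfolding G'_def by (rule has_derivative_scaleR[OF dw dv])
    have bG': "exp_sq_bounded b (\<lambda>x. G' x d)" for d
      unfolding G'_def
      by (intro exp_sq_bounded_add exp_sq_bounded_scaleR[OF bw bH[of \<epsilon>]] exp_sq_bounded_scaleR[OF bdw bv])
         (use \<epsilon> in \<open>auto simp: b_def\<close>)
    note R = gauss_rotation_derivative[OF dv dG _ b bv bH bwv bG']
    have D: "(q has_real_derivative - sin t * (\<integral>z. K t z \<partial>gauss)) (at t)" for t
      unfolding q_def[abs_def] X_def K_def by (rule R(1)) (use \<epsilon> in simp_all)
    have I: "integrable gauss (\<lambda>z. H (X t z) e \<bullet> G' (fst z) e)" for t e
      unfolding X_def by (rule R(2)) (use \<epsilon> in simp_all)
    have le: "K t z \<le> h\<^sup>2 * w (fst z) + y * ((norm (v (fst z)))\<^sup>2 * w (fst z))" for t z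
    proof -
      let ?v = "v (fst z)"
      \<comment> \<open>The two parts of \<open>G'\<close> behave differently: differentiating
        \<open>v\<close> gives a Hilbert-Schmidt product of Hessians at two points, differentiating
        the tilt gives a quadratic form that only sees the operator norm.\<close>
      have "K t z = w (fst z) * (\<Sum>e\<in>Basis. H (X t z) e \<bullet> H (fst z) e) + (s * w (fst z)) * (?v \<bullet> H (X t z) ?v)"
        unfolding K_def G'_def inner_add_right sum.distrib inner_scaleR_right sum_distrib_left H_eq[of "X t z" ?v] inner_sum_right
        by (intro arg_cong2[of _ _ _ _ "(+)"] sum.cong) (auto simp: inner_commute)
      also have "\<dots> \<le> w (fst z) * h\<^sup>2 + (s * w (fst z)) * (h * (norm ?v)\<^sup>2)"
        using w_pos[of "fst z"] s by (intro add_mono mult_left_mono inner_H_le bound_v) auto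
      finally show ?thesis by (simp add: y_def algebra_simps)
    qed
    have le': "(\<integral>z. K t z \<partial>gauss) \<le> (h\<^sup>2 * A + y * Q) + 0 * cos t" for t
    proof -
      have "(\<integral>z. K t z \<partial>gauss) \<le> (\<integral>z. h\<^sup>2 * w (fst z) + y * ((norm (v (fst z)))\<^sup>2 * w (fst z)) \<partial>(gauss :: ('a \<times> 'a) measure))"
        unfolding K_def
        by (intro integral_mono Bochner_Integration.integrable_sum I integrable_mult_right Bochner_Integration.integrable_add iw_fst(2) iQ_fst(2) le[unfolded K_def])
      also have "\<dots> = h\<^sup>2 * A + y * Q"
        using iw_fst iQ_fst by (simp add: A_def Q_def)
      finally show ?thesis by simp
    qed
    have "q t \<le> q (pi / 2) + (h\<^sup>2 * A + y * Q) * cos t + 0 * (cos t)\<^sup>2 / 2"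
      by (rule cos_comparison[OF D le' t])
    moreover have "q (pi / 2) = N"
      unfolding q_def X0 N_eq m_def
      by (rule gauss_integral_inner_indep[OF bv bwv _ b]) (use \<epsilon> in auto)
    ultimately show ?thesis by simp
  qed
  have "q 0 = Q"
    using iQ_fst(1) by (simp add: q_def X0 Q_def power2_norm_eq_inner mult.commute)
  then show "Q \<le> N + (h\<^sup>2 * A + s * h * Q)"
    using q_le[of 0] by (simp add: y_def)

  assume f0: "(\<integral>x. f x \<partial>gauss) = 0"
  define r where "r t = (\<integral>z. f (X t z) \<bullet> w (fst z) \<partial>gauss)" for t
  have D: "(r has_real_derivative - sin t * (s * q t)) (at t)" for t
  proof -
    have "(r has_real_derivative - sin t * (\<integral>z. (\<Sum>e\<in>Basis. (v (X t z) \<bullet> e) \<bullet> (s * (v (fst z) \<bullet> e) * w (fst z))) \<partial>gauss)) (at t)"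
      unfolding r_def[abs_def] X_def
      by (rule gauss_rotation_derivative(1)[where a=\<epsilon> and b=b, OF df dw _ b bf bvd bw' bdw']) (use \<epsilon> in auto)
    moreover have "(\<Sum>e\<in>Basis. (v (X t z) \<bullet> e) \<bullet> (s * (v (fst z) \<bullet> e) * w (fst z))) = s * (v (X t z) \<bullet> (w (fst z) *\<^sub>R v (fst z)))" for z
      by (subst (3) euclidean_inner) (simp add: sum_distrib_left sum_distrib_right mult_ac)
    ultimately show ?thesis by (simp add: q_def)
  qed
  \<comment> \<open>The half in the last term is the integral of sin t cos t over the quarter turn;
    it is what the bound on \<open>q\<close> at every angle gains over the bound at 0.\<close>
  have "r 0 \<le> r (pi / 2) + s * N * cos 0 + s * (h\<^sup>2 * A + y * Q) * (cos 0)\<^sup>2 / 2"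
    by (rule cos_comparison[OF D]) (use q_le s in \<open>auto simp: mult.assoc distrib_left[symmetric] intro!: mult_left_mono\<close>)
  moreover have "r (pi / 2) = 0"
  proof -
    have "r (pi / 2) = (\<integral>x. f x \<partial>gauss) \<bullet> A"
      unfolding r_def X0 A_def
      by (rule gauss_integral_inner_indep[OF bf bw' _ b]) (use \<epsilon> in auto)
    then show ?thesis by (simp add: f0)
  qed
  moreover have "r 0 = (\<integral>x. f x * w x \<partial>gauss)"
  proof -
    have "integrable gauss (\<lambda>x. f x * w x)"
      by (rule integrable_gauss_exp_sq_bounded[OF exp_sq_bounded_mult[OF bf bw], of "y / 2 + 2 * \<epsilon>"])
         (use b \<epsilon> in \<open>auto simp: b_def\<close>)
    from gauss_integral_fst(1)[OF this] show ?thesis by (simp add: r_def X0)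
  qed
  ultimately show "(\<integral>x. f x * w x \<partial>gauss) \<le> s * (N + (h\<^sup>2 * A + s * h * Q) / 2)"
    by (simp add: y_def algebra_simps)
qed

end

text \<open>
  With \<open>y = s * h\<close>, the right-hand side times \<open>s\<close> is \<open>A\<close> times the derivative of
  \<open>s\<^sup>2 * (m2 + 2/3 * h2) / (2 * (1 - s * h))\<close>. The sharp constant in place of \<open>2/3\<close> would be \<open>1/2\<close>;
  \<open>2/3\<close> is small enough for \<open>tail_threshold\<close>.
\<close>

lemma sub_gamma_derivative_bound:
  fixes y m2 h2 A N Q R :: real
  assumes y: "0 \<le> y" "y < 1" and nn: "0 \<le> m2" "0 \<le> h2" "0 \<le> A"
    and N: "N \<le> m2 * A + y * (m2 / (2 * (1 - y)) * A + (1 - y) / 2 * Q)"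
    and Q: "Q \<le> N + (h2 * A + y * Q)"
  shows "N + (h2 * A + y * Q) / 2 \<le> (2 - y) / (2 * (1 - y)\<^sup>2) * (m2 + 2/3 * h2) * A"
proof -
  define z where "z = 1 - y"
  have z: "0 < z" "z \<le> 1" "y = 1 - z" using y by (auto simp: z_def)
  define u where "u = m2 * A / z"
  have u: "m2 * A = u * z" using z by (simp add: u_def)
  have u0: "u \<ge> 0" using z nn by (simp add: u_def)
  have N': "N \<le> u * z + y * (u / 2 + z / 2 * Q)"
  proof -
    have "m2 / (2 * z) * A = u / 2" using z(1) by (simp add: u_def)
    then show ?thesis using N by (simp only: u z_def[symmetric])
  qed
  \<comment> \<open>Eliminates \<open>N\<close>: its share \<open>y * z / 2 * Q\<close> moves to the
    left of \<open>z * Q \<le> N + h2 * A\<close>.\<close>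
  have "(2 - y) * z * Q \<le> (2 - y) * u + 2 * (h2 * A)"
    using Q N' unfolding z by (simp add: field_simps)
  then have "(2 - y) * (z * Q) / z \<le> ((2 - y) * u + 2 * (h2 * A)) / z"
    using z by (intro divide_right_mono) (auto simp: mult.assoc)
  then have Q': "(2 - y) * Q \<le> ((2 - y) * u + 2 * (h2 * A)) / z" using z by simp
  have "N + (h2 * A + y * Q) / 2 \<le> u * (2 - y) / 2 + h2 * A / 2 + y / 2 * ((2 - y) * Q)"
    using N' unfolding z by (simp add: field_simps)
  also have "\<dots> \<le> u * (2 - y) / 2 + h2 * A / 2 + y / 2 * (((2 - y) * u + 2 * (h2 * A)) / z)"
    using y by (intro add_left_mono mult_left_mono Q') auto
  also have "\<dots> = (2 - y) * u / (2 * z) + (h2 * A) * ((1 + y) / (2 * z))"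
    unfolding z(3) using z(1) by (simp add: field_simps)
  also have "\<dots> \<le> (2 - y) * u / (2 * z) + (h2 * A) * ((2 - y) / (2 * z\<^sup>2) * (2/3))"
  proof (intro add_left_mono mult_left_mono)
    \<comment> \<open>This sum of squares equals \<open>2 * (2 - y) - 3 * (1 + y) * (1 - y)\<close>,
      the slack left by the constant 2/3.\<close>
    have "0 \<le> (y - 1)\<^sup>2 + 2 * y\<^sup>2" by simp
    then have "3 * ((1 + y) * z) \<le> 2 * (2 - y)"
      by (simp add: z_def power2_eq_square field_simps)
    then have "(3 * ((1 + y) * z)) / (6 * z\<^sup>2) \<le> (2 * (2 - y)) / (6 * z\<^sup>2)"
      by (rule divide_right_mono) simp
    moreover have "(3 * ((1 + y) * z)) / (6 * z\<^sup>2) = (1 + y) / (2 * z)"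
      using z(1) by (simp add: power2_eq_square) (simp add: field_simps)
    moreover have "(2 * (2 - y)) / (6 * z\<^sup>2) = (2 - y) / (2 * z\<^sup>2) * (2/3)"
      using z(1) by (simp add: field_simps)
    ultimately show "(1 + y) / (2 * z) \<le> (2 - y) / (2 * z\<^sup>2) * (2/3)"
      by (simp only:)
  qed (use nn in auto)
  also have "\<dots> = (2 - y) / (2 * (1 - y)\<^sup>2) * (m2 + 2/3 * h2) * A"
    using z(1) by (simp add: u_def z_def[symmetric] field_simps power2_eq_square)
  finally show ?thesis .
qed

section \<open>Moment generating function and Chernoff bound\<close>

context hessian_bounded begin

lemma integrable_exp_f:
  assumes "\<bar>s\<bar> * h < 1"
  shows "integrable gauss (\<lambda>x. exp (s * f x))" "integrable gauss (\<lambda>x. f x * exp (s * f x))"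
proof -
  define k where "k = \<bar>s\<bar> * h"
  define e where "e = (1 - k) / 8"
  have k: "k < 1" using assms by (simp add: k_def)
  have e: "e > 0" using k by (simp add: e_def)
  have ek: "e + (k / 2 + e) < 1/2" unfolding e_def diff_divide_distrib using k by linarith
  have b: "exp_sq_bounded (k / 2 + e) (\<lambda>x. exp (s * f x))"
    by (rule exp_sq_bounded_exp_f) (use e in \<open>simp add: k_def\<close>)
  show "integrable gauss (\<lambda>x. exp (s * f x))"
    by (rule integrable_gauss_exp_sq_bounded[OF b]) (use e ek in auto)
  show "integrable gauss (\<lambda>x. f x * exp (s * f x))"
    by (rule integrable_gauss_exp_sq_bounded[OF exp_sq_bounded_mult[OF exp_sq_bounded_f[OF e] b order_refl] ek]) simp
qed

lemma mgf_derivative: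
  assumes s: "0 \<le> s" "s * h < 1"
  shows "((\<lambda>s. \<integral>x. exp (s * f x) \<partial>gauss) has_real_derivative (\<integral>x. f x * exp (s * f x) \<partial>gauss)) (at s)"
proof -
  \<comment> \<open>A still admissible parameter strictly beyond \<open>s\<close>, giving an open
    interval around \<open>s\<close>; for \<open>h = 0\<close> any larger number will do.\<close>
  obtain L where L: "s < L" "L * h < 1"
  proof (cases "h = 0")
    case False
    with h have "h > 0" by simp
    with s have "s < 1 / h" by (simp add: field_simps)
    then obtain L where "s < L" "L < 1 / h" using dense by blast
    with \<open>h > 0\<close> show ?thesis by (intro that[of L]) (auto simp: field_simps)
  qed (use that[of "s + 1"] in simp)
  \<comment> \<open>For \<open>\<bar>t\<bar> < L\<close>, \<open>exp (t * f x)\<close> is at most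
    the larger of its values at \<open>L\<close> and \<open>- L\<close>.\<close>
  define B where "B x = \<bar>f x * exp (L * f x)\<bar> + \<bar>f x * exp (- L * f x)\<bar>" for x
  have B: "integrable gauss B"
    unfolding B_def
    by (intro Bochner_Integration.integrable_add integrable_abs integrable_exp_f) (use s L in auto)
  show ?thesis
  proof (rule has_real_derivative_lebesgue_integral(1)[of s "- L" L _ _ _ B])
    show "((\<lambda>t. exp (t * f x)) has_real_derivative f x * exp (t * f x)) (at t)" for t x
      by (auto intro!: derivative_eq_intros)
    show "integrable gauss (\<lambda>x. exp (t * f x))" if t: "t \<in> {- L<..<L}" for t
    proof (rule integrable_exp_f)
      have "\<bar>t\<bar> * h \<le> L * h" using t h by (intro mult_right_mono) auto
      then show "\<bar>t\<bar> * h < 1" using L by simp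
    qed
    show "\<bar>f x * exp (t * f x)\<bar> \<le> B x" if t: "t \<in> {- L<..<L}" for t x
    proof -
      have "t * f x \<le> \<bar>t\<bar> * \<bar>f x\<bar>" by (metis abs_ge_self abs_mult)
      also have "\<dots> \<le> L * \<bar>f x\<bar>" using t by (intro mult_right_mono) auto
      finally have "t * f x \<le> L * f x \<or> t * f x \<le> - L * f x" by (cases "f x \<ge> 0") auto
      then have "exp (t * f x) \<le> exp (L * f x) + exp (- L * f x)"
        by (smt (verit) exp_le_cancel_iff exp_gt_zero)
      from mult_left_mono[OF this, of "\<bar>f x\<bar>"] show ?thesis
        by (simp add: B_def abs_mult distrib_left)
    qed
  qed (use s L B in auto)
qed

text \<open>Gronwall's argument: the bound on E[f w] says that the logarithmic derivative of the
  moment generating function is at most that of the claimed bound, so their quotient is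
  nonincreasing and starts at 1.\<close>

lemma mgf_le:
  assumes s: "0 \<le> s" "s * h < 1" and f0: "(\<integral>x. f x \<partial>gauss) = 0"
  defines "V \<equiv> (norm (\<integral>x. v x \<partial>gauss))\<^sup>2 + 2/3 * h\<^sup>2"
  shows "(\<integral>x. exp (s * f x) \<partial>gauss) \<le> exp (s\<^sup>2 * V / (2 * (1 - s * h)))"
proof -
  define A where "A s = (\<integral>x. exp (s * f x) \<partial>gauss)" for s
  define p where "p s = s\<^sup>2 * V / (2 * (1 - s * h))" for s
  define r where "r s = A s * exp (- p s)" for s
  have "r s \<le> r 0"
  proof (rule DERIV_nonpos_imp_nonincreasing[OF s(1)])
    fix t assume t: "0 \<le> t" "t \<le> s"
    have th: "t * h < 1" using t s(2) h by (meson le_less_trans mult_right_mono)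
    define R where "R = (\<integral>x. f x * exp (t * f x) \<partial>gauss)"
    define p' where "p' = t * ((2 - t * h) / (2 * (1 - t * h)\<^sup>2) * V)"
    have A0: "0 \<le> A t" unfolding A_def by simp
    have dA: "(A has_real_derivative R) (at t)"
      unfolding A_def[abs_def] R_def using t(1) th by (rule mgf_derivative)
    have dp: "(p has_real_derivative p') (at t)"
    proof -
      define z where "z = 1 - t * h"
      have z: "z \<noteq> 0" "t * h = 1 - z" using th by (auto simp: z_def)
      have "(p has_real_derivative (2 * t * V * (2 * (1 - t * h)) - t\<^sup>2 * V * (- 2 * h)) / (2 * (1 - t * h))\<^sup>2) (at t)"
        unfolding p_def[abs_def] using z by (auto intro!: derivative_eq_intros simp: power2_eq_square)
      also have "2 * t * V * (2 * (1 - t * h)) - t\<^sup>2 * V * (- 2 * h) = 2 * t * V * (2 * z + t * h)"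
        by (simp add: z_def power2_eq_square algebra_simps)
      also have "2 * t * V * (2 * z + t * h) / (2 * (1 - t * h))\<^sup>2 = p'"
        unfolding p'_def z(2) using z(1) by (simp add: power2_eq_square field_simps)
      finally show ?thesis .
    qed
    have dr: "(r has_real_derivative (R - A t * p') * exp (- p t)) (at t)"
      unfolding r_def[abs_def]
      by (rule DERIV_cong[OF DERIV_mult[OF dA DERIV_fun_exp[OF DERIV_minus[OF dp]]]]) (simp add: algebra_simps)
    have "R \<le> t * ((2 - t * h) / (2 * (1 - t * h)\<^sup>2) * V * A t)"
      unfolding R_def V_def A_def
      by (rule order_trans[OF tilted_mean[OF t(1) th f0] mult_left_mono[OF sub_gamma_derivative_bound[OF _ th _ _ _ tilted_gradient[OF t(1) th] tilted_gradient_sq[OF t(1) th]]]])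
         (use t h in auto)
    then have "R \<le> A t * p'" by (simp add: p'_def mult_ac)
    then show "\<exists>y. (r has_real_derivative y) (at t) \<and> y \<le> 0"
      using dr by (intro exI conjI) (assumption, simp add: mult_nonpos_nonneg)
  qed
  also have "r 0 = 1" by (simp add: r_def A_def p_def gauss.prob_space[unfolded space_gauss])
  finally show ?thesis by (simp add: r_def A_def p_def exp_minus field_simps)
qed

text \<open>The threshold is the inverse of the Legendre transform of s^2 V / (2 (1 - s h)), taken
  at the level r^2 / 2.\<close>

lemma upper_tail:
  assumes f0: "(\<integral>x. f x \<partial>gauss) = 0" and r: "0 \<le> r"
  defines "V \<equiv> (norm (\<integral>x. v x \<partial>gauss))\<^sup>2 + 2/3 * h\<^sup>2"
  assumes x: "sqrt V * r + h * r\<^sup>2 / 2 \<le> x" and V: "V > 0"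
  shows "measure gauss {z. f z > x} \<le> exp (- r\<^sup>2 / 2)"
proof -
  define d where "d = sqrt V + h * r"
  have d: "d > 0" using V r h by (simp add: d_def add_pos_nonneg)
  \<comment> \<open>The optimal Chernoff parameter for this level;
    \<open>1 - s * h = sqrt V / d\<close> stays positive because \<open>V > 0\<close>.\<close>
  define s where "s = r / d"
  have s: "0 \<le> s" using r d by (simp add: s_def)
  have sh: "1 - s * h = sqrt V / d" using d by (simp add: s_def d_def field_simps)
  have "s * h < 1" using sh V d by (metis diff_gt_0_iff_gt divide_pos_pos real_sqrt_gt_zero)
  note m = mgf_le[OF s this f0, folded V_def]
  have "s\<^sup>2 * V / (2 * (1 - s * h)) = (r\<^sup>2 * sqrt V / 2) / d"
  proof -
    have "V = sqrt V * sqrt V" using V by simp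
    then show ?thesis unfolding sh using d V by (simp add: s_def field_simps power2_eq_square)
  qed
  moreover have "s * x \<ge> s * (sqrt V * r + h * r\<^sup>2 / 2)" using s x by (rule mult_left_mono[rotated])
  moreover have "(r\<^sup>2 * sqrt V / 2) / d - s * (sqrt V * r + h * r\<^sup>2 / 2) = - r\<^sup>2 / 2"
  proof -
    have "(r\<^sup>2 * sqrt V / 2) / d - s * (sqrt V * r + h * r\<^sup>2 / 2)
        = (r\<^sup>2 * sqrt V / 2 - r * (sqrt V * r + h * r\<^sup>2 / 2)) / d"
      by (simp add: s_def diff_divide_distrib)
    also have "r\<^sup>2 * sqrt V / 2 - r * (sqrt V * r + h * r\<^sup>2 / 2) = - r\<^sup>2 / 2 * d"
      by (simp add: d_def power2_eq_square algebra_simps)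
    finally show ?thesis using d by simp
  qed
  ultimately have e: "s\<^sup>2 * V / (2 * (1 - s * h)) - s * x \<le> - r\<^sup>2 / 2" by linarith
  have i: "integrable gauss (\<lambda>z. exp (s * f z - s * x))"
    using integrable_exp_f(1)[of s] s \<open>s * h < 1\<close> by (simp add: exp_diff)
  have "measure gauss {z. f z > x} \<le> measure gauss {z \<in> space gauss. exp (s * f z - s * x) \<ge> 1}"
    using s by (intro gauss.finite_measure_mono) (auto intro!: mult_left_mono)
  also have "\<dots> \<le> (\<integral>z. exp (s * f z - s * x) \<partial>gauss) / 1"
    by (rule integral_Markov_inequality_measure[OF i, of "{}"]) auto
  also have "\<dots> = (\<integral>z. exp (s * f z) \<partial>gauss) * exp (- (s * x))"
    by (simp add: exp_diff exp_minus divide_inverse)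
  also have "\<dots> \<le> exp (s\<^sup>2 * V / (2 * (1 - s * h))) * exp (- (s * x))"
    by (intro mult_right_mono m) auto
  also have "\<dots> \<le> exp (- r\<^sup>2 / 2)" using e by (simp add: exp_add[symmetric])
  finally show ?thesis .
qed

lemma uminus: "hessian_bounded (\<lambda>x. - f x) (\<lambda>x. - v x) (\<lambda>x d. - H x d) h"
proof
  show "((\<lambda>x. - f x) has_derivative (\<lambda>d. - v x \<bullet> d)) (at x)" for x
    using has_derivative_minus[OF df[of x]] by (simp add: inner_minus_left)
qed (use dv h hilbert_schmidt in \<open>auto intro: has_derivative_minus\<close>)

lemma two_sided_tail:
  assumes f0: "(\<integral>x. f x \<partial>gauss) = 0" and r: "0 \<le> r"
  defines "V \<equiv> (norm (\<integral>x. v x \<partial>gauss))\<^sup>2 + 2/3 * h\<^sup>2"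
  assumes x: "sqrt V * r + h * r\<^sup>2 / 2 \<le> x" and V: "V > 0"
  shows "measure gauss {z. \<bar>f z\<bar> > x} \<le> 2 * exp (- r\<^sup>2 / 2)"
proof -
  interpret neg: hessian_bounded "\<lambda>x. - f x" "\<lambda>x. - v x" "\<lambda>x d. - H x d" h by (rule uminus)
  have "measure gauss {z. \<bar>f z\<bar> > x} \<le> measure gauss {z. f z > x} + measure gauss {z. - f z > x}"
    by (rule order_trans[OF gauss.finite_measure_mono measure_Un_le]) auto
  also have "\<dots> \<le> exp (- r\<^sup>2 / 2) + exp (- r\<^sup>2 / 2)"
    by (intro add_mono upper_tail neg.upper_tail)
       (use assms in \<open>auto simp: V_def\<close>)
  finally show ?thesis by simp
qed

lemma zero_if_degenerate:
  assumes f0: "(\<integral>x. f x \<partial>gauss) = 0" and v0: "(\<integral>x. v x \<partial>gauss) = 0" and h0: "h = 0"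
  shows "f x = 0"
proof -
  have vc: "v y = v 0" for y
  proof (rule has_derivative_zero_unique[of UNIV v])
    show "(v has_derivative (\<lambda>_. 0)) (at z)" for z
      by (rule has_derivative_eq_rhs[OF dv]) (use norm_H_le[of z] in \<open>simp add: h0 fun_eq_iff\<close>)
  qed auto
  then have "(\<integral>x. v x \<partial>gauss) = v 0"
    by (subst Bochner_Integration.integral_cong[OF refl, of _ _ "\<lambda>_. v 0"])
       (auto simp: gauss.prob_space[unfolded space_gauss])
  with v0 vc have v: "v y = 0" for y by metis
  have f: "f y = f 0" for y
    by (rule has_derivative_zero_unique[of UNIV f]) (use df in \<open>simp_all add: v\<close>)
  then have "(\<integral>x. f x \<partial>gauss) = f 0"
    by (subst Bochner_Integration.integral_cong[OF refl, of _ _ "\<lambda>_. f 0"])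
       (auto simp: gauss.prob_space[unfolded space_gauss])
  with f0 f show ?thesis by metis
qed

end

section \<open>Hessian entries and the tail threshold\<close>

text \<open>The mean value theorem along \<open>b\<close> turns the second difference into a
  difference of two gradients at points within \<open>s * C\<close> of \<open>x\<close>, which
  differentiability of \<open>v\<close> at the single point \<open>x\<close> controls.\<close>

lemma second_difference_bound:
  fixes f :: "'a::real_inner \<Rightarrow> real"
  assumes df: "\<And>y. (f has_derivative (\<lambda>d. v y \<bullet> d)) (at y)"
    and dv: "(v has_derivative H) (at x)" and e: "e > 0"
  shows "\<exists>\<delta>>0. \<forall>s. 0 < s \<longrightarrow> s < \<delta> \<longrightarrow>
    \<bar>f (x + s *\<^sub>R a + s *\<^sub>R b) - f (x + s *\<^sub>R a) - f (x + s *\<^sub>R b) + f x - s\<^sup>2 * (H a \<bullet> b)\<bar>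
      \<le> s\<^sup>2 * (2 * e * (norm a + norm b) * norm b)"
proof -
  have lin: "linear H" using dv by (rule has_derivative_linear)
  obtain d where d: "d > 0" "\<And>y. norm (y - x) < d \<Longrightarrow> norm (v y - v x - H (y - x)) \<le> e * norm (y - x)"
    using dv e by (auto simp: has_derivative_at_alt)
  define C where "C = norm a + norm b"
  have C: "C \<ge> 0" by (simp add: C_def)
  \<comment> \<open>The added 1 keeps the denominator positive when \<open>a\<close> and
    \<open>b\<close> vanish.\<close>
  define \<delta> where "\<delta> = d / (C + 1)"
  have \<delta>: "\<delta> > 0" using d(1) C by (simp add: \<delta>_def)
  have "\<bar>f (x + s *\<^sub>R a + s *\<^sub>R b) - f (x + s *\<^sub>R a) - f (x + s *\<^sub>R b) + f x - s\<^sup>2 * (H a \<bullet> b)\<bar>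
      \<le> s\<^sup>2 * (2 * e * C * norm b)" if s: "0 < s" "s < \<delta>" for s
  proof -
    have sd: "s * C < d"
    proof -
      have "s * C \<le> s * (C + 1)" using s by simp
      also have "\<dots> < d" using s C by (simp add: \<delta>_def field_simps)
      finally show ?thesis .
    qed
    define p where "p t = f (x + s *\<^sub>R a + t *\<^sub>R (s *\<^sub>R b)) - f (x + t *\<^sub>R (s *\<^sub>R b))" for t
    have line: "((\<lambda>t. f (y + t *\<^sub>R w)) has_real_derivative v (y + t *\<^sub>R w) \<bullet> w) (at t)" for y w t
    proof -
      have "((\<lambda>t. f (y + t *\<^sub>R w)) has_derivative (\<lambda>c. v (y + t *\<^sub>R w) \<bullet> (c *\<^sub>R w))) (at t)"
        by (rule has_derivative_compose[OF _ df]) (auto intro!: derivative_eq_intros)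
      then show ?thesis by (simp add: has_field_derivative_def mult_commute_abs)
    qed
    have "\<exists>t>0. t < 1 \<and> p 1 - p 0 = (1 - 0) * (v (x + s *\<^sub>R a + t *\<^sub>R (s *\<^sub>R b)) \<bullet> (s *\<^sub>R b) - v (x + t *\<^sub>R (s *\<^sub>R b)) \<bullet> (s *\<^sub>R b))"
      unfolding p_def by (rule MVT2, simp, rule DERIV_diff, rule line, rule line)
    then obtain t where t: "0 < t" "t < 1"
      and p: "p 1 - p 0 = s * ((v (x + s *\<^sub>R a + t *\<^sub>R (s *\<^sub>R b)) - v (x + t *\<^sub>R (s *\<^sub>R b))) \<bullet> b)"
      by (auto simp: inner_diff_left algebra_simps)
    define y where "y = x + s *\<^sub>R a + t *\<^sub>R (s *\<^sub>R b)"
    define z where "z = x + t *\<^sub>R (s *\<^sub>R b)"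
    have tb: "t * norm b \<le> norm b" using t by (simp add: mult_left_le_one_le)
    have "norm (y - x) \<le> norm (s *\<^sub>R a) + norm (t *\<^sub>R (s *\<^sub>R b))"
      unfolding y_def by (metis add.assoc add_diff_cancel_left' norm_triangle_ineq)
    also have "\<dots> = s * (norm a + t * norm b)" using s t by (simp add: algebra_simps)
    also have "\<dots> \<le> s * C" using s tb by (simp add: C_def)
    finally have ny: "norm (y - x) \<le> s * C" .
    have "norm (z - x) = s * (t * norm b)" using s t by (simp add: z_def)
    also have "\<dots> \<le> s * C" using s tb by (simp add: C_def add_increasing)
    finally have nz: "norm (z - x) \<le> s * C" .
    have ey: "norm (v y - v x - H (y - x)) \<le> e * (s * C)"
      using d(2)[of y] ny sd e by (meson le_less_trans less_imp_le mult_left_mono order_trans)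
    have ez: "norm (v z - v x - H (z - x)) \<le> e * (s * C)"
      using d(2)[of z] nz sd e by (meson le_less_trans less_imp_le mult_left_mono order_trans)
    have "y - x = s *\<^sub>R a + (z - x)" by (simp add: y_def z_def)
    then have "H (y - x) = s *\<^sub>R H a + H (z - x)"
      by (simp only: linear_add[OF lin] linear_scale[OF lin])
    then have "v y - v z - s *\<^sub>R H a = (v y - v x - H (y - x)) - (v z - v x - H (z - x))"
      by (simp add: algebra_simps)
    then have "norm (v y - v z - s *\<^sub>R H a) \<le> e * (s * C) + e * (s * C)"
      by (simp only:) (rule order_trans[OF norm_triangle_ineq4 add_mono[OF ey ez]])
    then have err: "\<bar>(v y - v z - s *\<^sub>R H a) \<bullet> b\<bar> \<le> (2 * e * s * C) * norm b"
      by (intro order_trans[OF Cauchy_Schwarz_ineq2] mult_right_mono) (auto simp: algebra_simps)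
    have "f (x + s *\<^sub>R a + s *\<^sub>R b) - f (x + s *\<^sub>R a) - f (x + s *\<^sub>R b) + f x - s\<^sup>2 * (H a \<bullet> b)
        = p 1 - p 0 - s\<^sup>2 * (H a \<bullet> b)" by (simp add: p_def)
    also have "\<dots> = s * ((v y - v z - s *\<^sub>R H a) \<bullet> b)"
      unfolding p y_def[symmetric] z_def[symmetric] by (simp add: inner_simps power2_eq_square algebra_simps)
    finally show ?thesis
      using mult_left_mono[OF err, of s] s(1) by (simp add: abs_mult power2_eq_square mult_ac)
  qed
  then show ?thesis using \<delta> unfolding C_def by blast
qed

text \<open>The second difference is symmetric in \<open>a\<close> and \<open>b\<close>, so both
  values are limits of the same quotient, without continuity of the second derivative. Symmetry
  carries the bounds \<open>l i k\<close>, given for \<open>i \<le> k\<close>, over to the whole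
  matrix.\<close>

lemma second_derivative_symmetric:
  fixes f :: "'a::real_inner \<Rightarrow> real"
  assumes df: "\<And>y. (f has_derivative (\<lambda>d. v y \<bullet> d)) (at y)"
    and dv: "(v has_derivative H) (at x)"
  shows "H a \<bullet> b = H b \<bullet> a"
proof -
  define C where "C = norm a + norm b"
  have C: "C \<ge> 0" by (simp add: C_def)
  have le: "\<bar>H a \<bullet> b - H b \<bullet> a\<bar> \<le> 2 * e * C * C" if e: "e > 0" for e
  proof -
    let ?D = "\<lambda>s. f (x + s *\<^sub>R a + s *\<^sub>R b) - f (x + s *\<^sub>R a) - f (x + s *\<^sub>R b) + f x"
    obtain \<delta>1 where 1: "\<delta>1 > 0" "\<And>s. 0 < s \<Longrightarrow> s < \<delta>1 \<Longrightarrow> \<bar>?D s - s\<^sup>2 * (H a \<bullet> b)\<bar> \<le> s\<^sup>2 * (2 * e * C * norm b)"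
      using second_difference_bound[OF df dv e, of a b] unfolding C_def by blast
    obtain \<delta>2 where 2: "\<delta>2 > 0" "\<And>s. 0 < s \<Longrightarrow> s < \<delta>2 \<Longrightarrow> \<bar>?D s - s\<^sup>2 * (H b \<bullet> a)\<bar> \<le> s\<^sup>2 * (2 * e * C * norm a)"
      using second_difference_bound[OF df dv e, of b a] unfolding C_def
      by (auto simp: add_ac) (smt (verit, best) add.commute add.left_commute)
    obtain s where s: "0 < s" "s < \<delta>1" "s < \<delta>2"
      using dense[of 0 "min \<delta>1 \<delta>2"] 1(1) 2(1) by auto
    have "\<bar>s\<^sup>2 * (H a \<bullet> b) - s\<^sup>2 * (H b \<bullet> a)\<bar> \<le> s\<^sup>2 * (2 * e * C * norm b) + s\<^sup>2 * (2 * e * C * norm a)"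
      using 1(2)[OF s(1,2)] 2(2)[OF s(1,3)] by linarith
    also have "\<dots> = s\<^sup>2 * (2 * e * C * C)" by (simp add: C_def algebra_simps)
    also have "\<bar>s\<^sup>2 * (H a \<bullet> b) - s\<^sup>2 * (H b \<bullet> a)\<bar> = s\<^sup>2 * \<bar>H a \<bullet> b - H b \<bullet> a\<bar>"
      by (simp add: right_diff_distrib[symmetric] abs_mult)
    finally have "s\<^sup>2 * \<bar>H a \<bullet> b - H b \<bullet> a\<bar> \<le> s\<^sup>2 * (2 * e * C * C)" .
    then show ?thesis using s(1) by simp
  qed
  have "\<bar>H a \<bullet> b - H b \<bullet> a\<bar> \<le> 0 + e" if "e > 0" for e
  proof -
    have "2 * (e / (2 * (C * C + 1))) * C * C \<le> e"
    proof -
      have "C * C / (C * C + 1) \<le> 1" using C by (simp add: divide_le_eq_1 add_nonneg_pos)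
      from mult_left_mono[OF this, of e] have "e * (C * C / (C * C + 1)) \<le> e" using that by simp
      moreover have "2 * (e / (2 * u)) * C * C = e * (C * C / u)" for u by simp
      ultimately show ?thesis by (simp only:)
    qed
    then show ?thesis using le[of "e / (2 * (C * C + 1))"] that C by (simp add: add_nonneg_pos)
  qed
  then have "\<bar>H a \<bullet> b - H b \<bullet> a\<bar> \<le> 0" by (rule field_le_epsilon)
  then show ?thesis by simp
qed

text \<open>Off-diagonal entries occur twice in the full matrix and diagonal ones once; this
  explains the weights in \<open>c\<close> and the choice \<open>h\<^sup>2 = 2 * c\<close>.\<close>

lemma sum_square_symmetrize:
  fixes l :: "'n::{finite,linorder} \<Rightarrow> 'n \<Rightarrow> real"
  shows "(\<Sum>k\<in>UNIV. \<Sum>i\<in>UNIV. (if i \<le> k then l i k else l k i)\<^sup>2)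
    = 2 * ((\<Sum>k\<in>UNIV. \<Sum>i\<in>{..<k}. (l i k)\<^sup>2) + 1/2 * (\<Sum>k\<in>UNIV. (l k k)\<^sup>2))"
proof -
  define S where "S i k = (if i < k then (l i k)\<^sup>2 else 0)" for i k
  have "(if i \<le> k then l i k else l k i)\<^sup>2 = S i k + S k i + (if i = k then (l i k)\<^sup>2 else 0)" for i k
    by (auto simp: S_def)
  then have "(\<Sum>k\<in>UNIV. \<Sum>i\<in>UNIV. (if i \<le> k then l i k else l k i)\<^sup>2)
      = (\<Sum>k\<in>UNIV. \<Sum>i\<in>UNIV. S i k) + (\<Sum>k\<in>UNIV. \<Sum>i\<in>UNIV. S k i) + (\<Sum>k\<in>UNIV. (l k k)\<^sup>2)"
    by (simp add: sum.distrib)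
  also have "(\<Sum>k\<in>UNIV. \<Sum>i\<in>UNIV. S k i) = (\<Sum>k\<in>UNIV. \<Sum>i\<in>UNIV. S i k)"
    by (rule sum.swap)
  also have "(\<Sum>k\<in>UNIV. \<Sum>i\<in>UNIV. S i k) = (\<Sum>k\<in>UNIV. \<Sum>i\<in>{..<k}. (l i k)\<^sup>2)"
    unfolding S_def by (rule sum.cong[OF refl], rule sum.mono_neutral_cong_right) auto
  finally show ?thesis by simp
qed

text \<open>
  The number \<open>\<rho>\<close> solves \<open>x = \<sigma> * \<rho> + sqrt c * \<rho>\<^sup>2\<close>, so the claimed bound is \<open>4 * exp (- \<rho>\<^sup>2 / 2)\<close>.
  The factor \<open>4\<close> instead of \<open>2\<close> is what allows the smaller \<open>r\<close> with \<open>r\<^sup>2 = \<rho>\<^sup>2 - 2 * ln 2\<close>.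
\<close>

lemma tail_threshold:
  fixes x \<sigma> c q :: real
  defines "d \<equiv> \<sigma> + sqrt (\<sigma>\<^sup>2 + 4 * sqrt c * x)"
  defines "\<rho> \<equiv> 2 * x / d"
  defines "r \<equiv> sqrt (\<rho>\<^sup>2 - 2 * ln 2)"
  assumes x: "0 \<le> x" and c: "0 \<le> c" and q: "0 \<le> q" "q \<le> \<sigma>" and d: "d \<noteq> 0"
    and \<rho>: "2 * ln 2 \<le> \<rho>\<^sup>2"
  shows "sqrt (q\<^sup>2 + 2/3 * (sqrt (2 * c))\<^sup>2) * r + sqrt (2 * c) * r\<^sup>2 / 2 \<le> x"
proof -
  have \<sigma>: "0 \<le> \<sigma>" using q by simp
  have d0: "d > 0"
  proof -
    have "d \<ge> 0" using \<sigma> x c by (simp add: d_def)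
    with d show ?thesis by simp
  qed
  have \<rho>0: "\<rho> \<ge> 0" using x d0 by (simp add: \<rho>_def)
  have r2: "r\<^sup>2 = \<rho>\<^sup>2 - 2 * ln 2" and r0: "0 \<le> r" using \<rho> by (simp_all add: r_def)
  have "r\<^sup>2 \<le> \<rho>\<^sup>2" using r2 by simp
  then have r\<rho>: "r \<le> \<rho>" using \<rho>0 by (rule power2_le_imp_le)
  have x_eq: "x = \<sigma> * \<rho> + sqrt c * \<rho>\<^sup>2"
  proof -
    \<comment> \<open>\<open>d\<close> is a root of d^2 - 2 \<sigma> d = 4 sqrt(c) x, which becomes
      the equation for \<open>\<rho>\<close> upon substituting
      \<open>\<rho> = 2 * x / d\<close>.\<close>
    have "(d - \<sigma>)\<^sup>2 = \<sigma>\<^sup>2 + 4 * sqrt c * x" using x c by (simp add: d_def)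
    then have "4 * sqrt c * x = d * d - 2 * d * \<sigma>" by (simp add: power2_eq_square algebra_simps)
    then have *: "4 * sqrt c * x * x = (d * d - 2 * d * \<sigma>) * x" by simp
    have "\<sigma> * \<rho> + sqrt c * \<rho>\<^sup>2 = (2 * x * \<sigma> * d + 4 * sqrt c * x * x) / (d * d)"
      using d0 by (simp add: \<rho>_def power2_eq_square field_simps)
    also have "\<dots> = x" unfolding * using d0 by (simp add: field_simps)
    finally show ?thesis by simp
  qed
  \<comment> \<open>The left side is sqrt(q^2 + 4/3 c), and \<open>231/200\<close> is slightly more
    than sqrt(4/3). Likewise \<open>14143/10000\<close> below is slightly more than sqrt(2).\<close>
  have V: "sqrt (q\<^sup>2 + 2/3 * (sqrt (2 * c))\<^sup>2) \<le> \<sigma> + 231/200 * sqrt c"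
  proof (rule real_le_lsqrt)
    have "q\<^sup>2 \<le> \<sigma>\<^sup>2" using q by (intro power_mono) auto
    moreover have "0 \<le> \<sigma> * sqrt c" using \<sigma> c by simp
    moreover have "(\<sigma> + 231/200 * sqrt c)\<^sup>2 = \<sigma>\<^sup>2 + 231/100 * (\<sigma> * sqrt c) + 53361/40000 * c"
      using c by (simp add: power2_sum power_mult_distrib) (simp add: power2_eq_square)
    moreover have "(sqrt (2 * c))\<^sup>2 = 2 * c" using c by simp
    ultimately show "q\<^sup>2 + 2/3 * (sqrt (2 * c))\<^sup>2 \<le> (\<sigma> + 231/200 * sqrt c)\<^sup>2"
      using c by linarith
  qed (use \<sigma> c in auto)
  have h: "sqrt (2 * c) \<le> 14143/10000 * sqrt c"
    unfolding real_sqrt_mult using c by (intro mult_right_mono real_le_lsqrt) (auto simp: power2_eq_square)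
  have "sqrt (q\<^sup>2 + 2/3 * (sqrt (2 * c))\<^sup>2) * r + sqrt (2 * c) * r\<^sup>2 / 2
      \<le> (\<sigma> + 231/200 * sqrt c) * r + 14143/10000 * sqrt c * r\<^sup>2 / 2"
    using V h r0 by (intro add_mono divide_right_mono mult_right_mono) auto
  also have "\<dots> = \<sigma> * r + sqrt c * (231/200 * r + 14143/20000 * r\<^sup>2)"
    by (simp add: algebra_simps)
  also have "\<dots> \<le> \<sigma> * \<rho> + sqrt c * \<rho>\<^sup>2"
  proof (intro add_mono mult_left_mono)
    \<comment> \<open>The leading coefficient is \<open>1 - 14143/20000\<close>, and 2 is close to
      the minimiser of the difference of the two sides. The constant \<open>4/3\<close> is available
      because \<open>2 * ln 2\<close> exceeds it.\<close>
    have "0 \<le> 5857/20000 * (r - 2)\<^sup>2" by simp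
    then have "231/200 * r + 14143/20000 * r\<^sup>2 \<le> r\<^sup>2 + 4/3"
      using r0 by (simp add: power2_eq_square algebra_simps)
    also have "\<dots> \<le> \<rho>\<^sup>2" using ln2_ge_two_thirds r2 by simp
    finally show "231/200 * r + 14143/20000 * r\<^sup>2 \<le> \<rho>\<^sup>2" .
  qed (use \<sigma> c r\<rho> in auto)
  finally show ?thesis using x_eq by simp
qed

section \<open>From iterated partial derivatives to gradient and Hessian\<close>

lemma twice_differentiable_gradient:
  fixes f :: "real ^ 'n::finite \<Rightarrow> real"
  assumes "twice_differentiable f"
  obtains v H where "\<And>x. (f has_derivative (\<lambda>d. v x \<bullet> d)) (at x)"
    and "\<And>x. (v has_derivative H x) (at x)"
    and "\<And>i k x. partial_deriv k (partial_deriv i f) x = H x (axis k 1) \<bullet> axis i 1"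
proof -
  obtain f' :: "real ^ 'n \<Rightarrow> (real ^ 'n) \<Rightarrow>\<^sub>L real"
    where f': "\<And>x. (f has_derivative blinfun_apply (f' x)) (at x)" and "\<And>x. f' differentiable (at x)"
    using assms unfolding twice_differentiable_def by blast
  then have "\<forall>x. \<exists>D. (f' has_derivative D) (at x)" by (simp add: differentiable_def)
  then obtain f'' where f'': "\<And>x. (f' has_derivative f'' x) (at x)" by metis
  \<comment> \<open>Riesz representatives of the derivative functional and of its own
    derivative.\<close>
  define v where "v x = (\<Sum>e\<in>Basis. f' x e *\<^sub>R e)" for x
  define H where "H x d = (\<Sum>e\<in>Basis. f'' x d e *\<^sub>R e)" for x d
  have vd: "v x \<bullet> d = f' x d" for x d
  proof -
    have "f' x d = f' x (\<Sum>e\<in>Basis. (d \<bullet> e) *\<^sub>R e)" by (simp add: euclidean_representation)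
    also have "\<dots> = (\<Sum>e\<in>Basis. (d \<bullet> e) * f' x e)"
      by (simp add: blinfun.sum_right blinfun.scaleR_right)
    also have "\<dots> = v x \<bullet> d"
      unfolding v_def inner_sum_left inner_scaleR_left
      by (intro sum.cong refl) (simp add: inner_commute mult.commute)
    finally show ?thesis ..
  qed
  have df: "(f has_derivative (\<lambda>d. v x \<bullet> d)) (at x)" for x
    using f'[of x] by (simp add: vd)
  have dv: "(v has_derivative H x) (at x)" for x
    unfolding v_def[abs_def] H_def
    by (intro has_derivative_sum has_derivative_scaleR_left
        bounded_linear.has_derivative[OF blinfun.bounded_linear_left f''])
  \<comment> \<open>Needed at every \<open>y\<close>, as an identity of functions, before the outer
    partial derivative can be taken.\<close>
  have p1: "partial_deriv i f y = v y \<bullet> axis i 1" for i y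
  proof -
    have "((\<lambda>t. f (y + t *\<^sub>R axis i 1)) has_derivative (\<lambda>t. v y \<bullet> (t *\<^sub>R axis i 1))) (at 0)"
      by (rule has_derivative_compose[of "\<lambda>t. y + t *\<^sub>R axis i 1" _ 0 UNIV f, simplified])
         (auto intro!: derivative_eq_intros df)
    then have "((\<lambda>t. f (y + t *\<^sub>R axis i 1)) has_real_derivative v y \<bullet> axis i 1) (at 0)"
      by (simp add: has_field_derivative_def mult_commute_abs)
    then show ?thesis unfolding partial_deriv_def by (rule DERIV_imp_deriv)
  qed
  have p2: "partial_deriv k (partial_deriv i f) x = H x (axis k 1) \<bullet> axis i 1" for i k x
  proof -
    have "((\<lambda>t. v (x + t *\<^sub>R axis k 1)) has_derivative (\<lambda>t. H x (t *\<^sub>R axis k 1))) (at 0)"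
      by (rule has_derivative_compose[of "\<lambda>t. x + t *\<^sub>R axis k 1" _ 0 UNIV v, simplified])
         (auto intro!: derivative_eq_intros dv)
    then have "((\<lambda>t. v (x + t *\<^sub>R axis k 1) \<bullet> axis i 1) has_derivative (\<lambda>t. H x (t *\<^sub>R axis k 1) \<bullet> axis i 1)) (at 0)"
      by (rule has_derivative_inner_left)
    then have "((\<lambda>t. v (x + t *\<^sub>R axis k 1) \<bullet> axis i 1) has_real_derivative H x (axis k 1) \<bullet> axis i 1) (at 0)"
      using linear_scale[OF has_derivative_linear[OF dv]]
      by (simp add: has_field_derivative_def mult_commute_abs)
    then show ?thesis unfolding p1 partial_deriv_def[of k] by (rule DERIV_imp_deriv)
  qed
  show thesis by (rule that[OF df dv p2])
qed

theorem proposition4p1: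
  fixes M :: "'a measure"
    and Z :: "'a \<Rightarrow> real ^ 'n::{finite,linorder}"
    and f :: "real ^ 'n::{finite,linorder} \<Rightarrow> real"
    and l :: "'n::{finite,linorder} \<Rightarrow> 'n \<Rightarrow> real"
    and F :: "'a \<Rightarrow> real"
    and \<sigma> c x :: real
  assumes "prob_space M"
    and "std_gaussian_vector M Z"
    and "twice_differentiable f"
    and "\<And>i k. i \<le> k \<Longrightarrow> bdd_above (range (\<lambda>y. \<bar>partial_deriv k (partial_deriv i f) y\<bar>))"
    and "\<And>i k. i \<le> k \<Longrightarrow> l i k = (SUP y. \<bar>partial_deriv k (partial_deriv i f) y\<bar>)"
    and "F = (\<lambda>\<omega>. f (Z \<omega>))"
    and "\<sigma> = sqrt (prob_space.variance M F)"
    and "c = (\<Sum>k\<in>UNIV. \<Sum>i\<in>{..<k}. (l i k)\<^sup>2) + 1/2 * (\<Sum>k\<in>UNIV. (l k k)\<^sup>2)"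
    and "x \<ge> 0"
  shows "\<P>(\<omega> in M. \<bar>F \<omega> - prob_space.expectation M F\<bar> > x)
           \<le> 4 * exp (- (2 * x\<^sup>2 / (\<sigma> + sqrt (\<sigma>\<^sup>2 + 4 * sqrt c * x))\<^sup>2))
         \<and> (x > 0 \<and> \<sigma> + sqrt (\<sigma>\<^sup>2 + 4 * sqrt c * x) = 0 \<longrightarrow>
              \<P>(\<omega> in M. \<bar>F \<omega> - prob_space.expectation M F\<bar> > x) = 0)"
proof -
  interpret M: prob_space M by fact
  obtain v H where df: "\<And>x. (f has_derivative (\<lambda>d. v x \<bullet> d)) (at x)"
    and dv: "\<And>x. (v has_derivative H x) (at x)"
    and pd: "\<And>i k x. partial_deriv k (partial_deriv i f) x = H x (axis k 1) \<bullet> axis i 1"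
    using twice_differentiable_gradient[OF assms(3)] by blast
  define h where "h = sqrt (2 * c)"
  have c0: "0 \<le> c" unfolding assms(8) by (intro add_nonneg_nonneg mult_nonneg_nonneg sum_nonneg) auto
  have l: "\<bar>H y (axis k 1) \<bullet> axis i 1\<bar> \<le> l i k" if "i \<le> k" for i k y
    using cSUP_upper[OF UNIV_I assms(4)[OF that], of y] assms(5)[OF that] by (simp add: pd)
  have sym: "H y (axis k 1) \<bullet> axis i 1 = H y (axis i 1) \<bullet> axis k 1" for i k y
    by (rule second_derivative_symmetric[OF df dv])
  have "(\<Sum>e\<in>Basis. (norm (H y e))\<^sup>2) \<le> h\<^sup>2" for y
  proof -
    have B: "(Basis :: (real, 'n) vec set) = (\<lambda>i. axis i 1) ` UNIV" by (auto simp: Basis_vec_def)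
    have sB: "(\<Sum>e\<in>(Basis :: (real, 'n) vec set). p e) = (\<Sum>k\<in>UNIV. p (axis k 1))" for p :: "(real, 'n) vec \<Rightarrow> real"
      unfolding B by (subst sum.reindex) (auto simp: inj_on_def axis_eq_axis)
    have "(\<Sum>e\<in>Basis. (norm (H y e))\<^sup>2) = (\<Sum>k\<in>UNIV. \<Sum>i\<in>UNIV. (H y (axis k 1) \<bullet> axis i 1)\<^sup>2)"
      by (simp only: norm_sq_sum_Basis sB)
    also have "\<dots> \<le> (\<Sum>k\<in>UNIV. \<Sum>i\<in>UNIV. (if i \<le> k then l i k else l k i)\<^sup>2)"
    proof (intro sum_mono)
      fix k i :: 'n
      have "\<bar>H y (axis k 1) \<bullet> axis i 1\<bar> \<le> (if i \<le> k then l i k else l k i)"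
        using l[of i k y] l[of k i y] sym[of y k i] by auto
      then show "(H y (axis k 1) \<bullet> axis i 1)\<^sup>2 \<le> (if i \<le> k then l i k else l k i)\<^sup>2"
        by (metis abs_ge_zero power2_abs power_mono)
    qed
    also have "\<dots> = h\<^sup>2" using c0 unfolding sum_square_symmetrize assms(8)[symmetric] by (simp add: h_def)
    finally show ?thesis .
  qed
  note HS = this
  interpret f: hessian_bounded f v H h by unfold_locales (use df dv HS c0 in \<open>auto simp: h_def\<close>)
  \<comment> \<open>Centring leaves gradient and Hessian unchanged, so \<open>v\<close>,
    \<open>H\<close> and \<open>h\<close> serve for \<open>g\<close> too.\<close>
  define \<mu> where "\<mu> = (\<integral>z. f z \<partial>gauss)"
  define g where "g z = f z - \<mu>" for z
  interpret g: hessian_bounded g v H h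
    unfolding g_def by unfold_locales (use df dv HS c0 in \<open>auto simp: h_def intro!: derivative_eq_intros\<close>)
  have g0: "(\<integral>z. g z \<partial>gauss) = 0"
    using f.integrable_f by (simp add: g_def \<mu>_def gauss.prob_space[unfolded space_gauss])
  note Z = distr_std_gaussian_vector[OF assms(1,2)]
  note [measurable] = Z(1)
  have EF: "M.expectation F = \<mu>"
    using integral_distr[OF Z(1) f.f_measurable] by (simp add: Z(2) \<mu>_def assms(6))
  have "M.variance F = (\<integral>z. (g z)\<^sup>2 \<partial>gauss)"
    unfolding EF using integral_distr[OF Z(1), of "\<lambda>z. (g z)\<^sup>2"] by (simp add: Z(2) g_def assms(6))
  then have \<sigma>: "\<sigma> = sqrt (\<integral>z. (g z)\<^sup>2 \<partial>gauss)" by (simp add: assms(7))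
  define q where "q = norm (\<integral>z. v z \<partial>gauss)"
  have q: "0 \<le> q" "q \<le> \<sigma>"
    unfolding q_def \<sigma> using g.norm_mean_gradient_le_variance[OF g0] by (auto intro: real_le_rsqrt)
  define P where "P = \<P>(\<omega> in M. \<bar>F \<omega> - M.expectation F\<bar> > x)"
  have P: "P = measure gauss {z. \<bar>g z\<bar> > x}"
  proof -
    have "{z. \<bar>g z\<bar> > x} \<in> sets borel" by measurable
    then have "measure (distr M borel Z) {z. \<bar>g z\<bar> > x} = measure M (Z -` {z. \<bar>g z\<bar> > x} \<inter> space M)"
      by (intro measure_distr) auto
    moreover have "Z -` {z. \<bar>g z\<bar> > x} \<inter> space M = {\<omega> \<in> space M. \<bar>F \<omega> - \<mu>\<bar> > x}"
      by (auto simp: g_def assms(6))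
    ultimately show ?thesis by (simp add: P_def Z(2) EF)
  qed
  have P1: "P \<le> 1" unfolding P_def by simp
  have degenerate: "P = 0" if "q = 0" "c = 0"
  proof -
    have "g z = 0" for z
      by (rule g.zero_if_degenerate[OF g0]) (use that in \<open>simp_all add: q_def h_def\<close>)
    then show ?thesis using assms(9) by (simp add: P)
  qed
  define d where "d = \<sigma> + sqrt (\<sigma>\<^sup>2 + 4 * sqrt c * x)"
  have \<sigma>0: "0 \<le> \<sigma>" using q by simp
  have "P = 0" if "x > 0" "d = 0"
  proof (rule degenerate)
    have "0 \<le> sqrt (\<sigma>\<^sup>2 + 4 * sqrt c * x)" using c0 assms(9) by simp
    with that \<sigma>0 have "\<sigma> = 0" "sqrt (\<sigma>\<^sup>2 + 4 * sqrt c * x) = 0" unfolding d_def by linarith+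
    then show "q = 0" "c = 0" using q that(1) by auto
  qed
  moreover have "P \<le> 4 * exp (- (2 * x\<^sup>2 / d\<^sup>2))"
  \<comment> \<open>A bound of at least 1 is trivial; below 1 it forces
    \<open>\<rho>\<^sup>2\<close> above \<open>4 * ln 2\<close>, so that the square root defining
    \<open>r\<close> has a nonnegative argument.\<close>
  proof (cases "4 * exp (- (2 * x\<^sup>2 / d\<^sup>2)) \<ge> 1")
    case True
    with P1 show ?thesis by linarith
  next
    case False
    define \<rho> where "\<rho> = 2 * x / d"
    have \<rho>2: "2 * x\<^sup>2 / d\<^sup>2 = \<rho>\<^sup>2 / 2" by (simp add: \<rho>_def power_divide power_mult_distrib)
    \<comment> \<open>For \<open>d = 0\<close> the quotient is 0 by convention, the bound is 4, and
      the trivial case applies.\<close>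
    have "d \<noteq> 0" using False by auto
    have "\<rho>\<^sup>2 / 2 \<ge> 2 * ln 2"
    proof (rule ccontr)
      assume "\<not> ?thesis"
      then have "exp (- (2 * ln 2)) \<le> exp (- (\<rho>\<^sup>2 / 2))" by simp
      moreover have "exp (- (2 * ln 2)) = 1 / (4::real)"
        by (simp add: exp_minus exp_double power2_eq_square)
      ultimately show False using False by (simp add: \<rho>2)
    qed
    then have \<rho>: "\<rho>\<^sup>2 \<ge> 2 * ln 2" using ln2_ge_two_thirds by linarith
    define r where "r = sqrt (\<rho>\<^sup>2 - 2 * ln 2)"
    have r: "0 \<le> r" "r\<^sup>2 = \<rho>\<^sup>2 - 2 * ln 2" using \<rho> by (simp_all add: r_def)
    show ?thesis
    proof (cases "q = 0 \<and> c = 0")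
      case True
      with degenerate show ?thesis by simp
    next
      case nd: False
      have "P \<le> 2 * exp (- r\<^sup>2 / 2)"
        unfolding P
      proof (rule g.two_sided_tail[OF g0 r(1)])
        show "sqrt ((norm (\<integral>z. v z \<partial>gauss))\<^sup>2 + 2/3 * h\<^sup>2) * r + h * r\<^sup>2 / 2 \<le> x"
          using tail_threshold[OF assms(9) c0 q] \<open>d \<noteq> 0\<close> \<rho>
          by (simp add: q_def h_def d_def \<rho>_def r_def)
        show "0 < (norm (\<integral>z. v z \<partial>gauss))\<^sup>2 + 2/3 * h\<^sup>2"
          using nd c0 unfolding q_def[symmetric] h_def
          by (auto simp: add_pos_nonneg add_nonneg_pos)
      qed
      \<comment> \<open>Lowering \<open>\<rho>\<^sup>2\<close> by \<open>2 * ln 2\<close> costs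
        exactly a factor 2, which raises the two-sided constant from 2 to 4.\<close>
      also have "2 * exp (- r\<^sup>2 / 2) = 2 * (exp (- (\<rho>\<^sup>2 / 2)) * exp (ln 2))"
        unfolding exp_add[symmetric] by (simp add: r(2) field_simps)
      also have "\<dots> = 4 * exp (- (2 * x\<^sup>2 / d\<^sup>2))" by (simp add: \<rho>2)
      finally show ?thesis .
    qed
  qed
  ultimately show ?thesis unfolding P_def d_def by blast
qed

end
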